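(* \textsc{MD-SPP} restricted to instances with target $T\le 1$ is fixed-parameter tractable when parameterized by the number $|K|$ of commodities.
   Context: For a digraph $D=(V,E)$, $\mathcal{T}(D)$ is its transitive closure (edge $(i,j)$ iff $D$ has a directed $i$-$j$-path); for a directed path $P$, $\mathcal{T}(P)$ is the transitive closure of $P$. \textsc{MD-SPP}: input is a digraph $D$, an integer $T$ (the target), and a set $K$ of routed commodities $(s,t,P)$ with $s,t\in V$ and $P$ a directed $s$-$t$-path in $D$; the question is whether there is a subgraph $H$ of $\mathcal{T}(D)$ of maximum outdegree at most $T$ such that for every $(s,t,P)\in K$ there is a directed $s$-$t$-path in $H\cap\mathcal{T}(P)$. *)

theory Defs
  imports "Graph_Theory.Digraph_Component_Vwalk"
begin

section \<open>Machine model\<close>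

text \<open>
  Algorithms are programs of Jones's language WHILE (N. D. Jones, Computability and Complexity
  from a Programming Perspective, MIT Press 1997): finitely many variables that hold binary
  trees, and one time unit for every elementary operation. If trees are stored as shared
  pointer structures, every elementary operation takes constant time, so running times
  agree with those of Turing machines up to a polynomial.
\<close>

datatype data = Leaf | Node data data

primrec left :: "data \<Rightarrow> data" where
  "left Leaf = Leaf"
| "left (Node a b) = a"

primrec right :: "data \<Rightarrow> data" where
  "right Leaf = Leaf"
| "right (Node a b) = b"

primrec data_size :: "data \<Rightarrow> nat" where
  "data_size Leaf = 1"
| "data_size (Node a b) = 1 + data_size a + data_size b"

datatype expr = EVar nat | ELeaf | ENode expr expr | ELeft expr | ERight expr

type_synonym store = "nat \<Rightarrow> data"

primrec eval_expr :: "expr \<Rightarrow> store \<Rightarrow> data" where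
  "eval_expr (EVar i) \<sigma> = \<sigma> i"
| "eval_expr ELeaf \<sigma> = Leaf"
| "eval_expr (ENode e1 e2) \<sigma> = Node (eval_expr e1 \<sigma>) (eval_expr e2 \<sigma>)"
| "eval_expr (ELeft e) \<sigma> = left (eval_expr e \<sigma>)"
| "eval_expr (ERight e) \<sigma> = right (eval_expr e \<sigma>)"

primrec expr_time :: "expr \<Rightarrow> nat" where
  "expr_time (EVar i) = 1"
| "expr_time ELeaf = 1"
| "expr_time (ENode e1 e2) = 1 + expr_time e1 + expr_time e2"
| "expr_time (ELeft e) = 1 + expr_time e"
| "expr_time (ERight e) = 1 + expr_time e"

datatype com = Skip | Assign nat expr | Seq com com | If expr com com | While expr com

text \<open>
  \<open>exec c \<sigma> t \<sigma>'\<close>: started in store \<open>\<sigma>\<close>, the program \<open>c\<close> halts after \<open>t\<close> time units in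
  store \<open>\<sigma>'\<close>. In tests, \<open>Leaf\<close> counts as false and every other tree as true.
\<close>

inductive exec :: "com \<Rightarrow> store \<Rightarrow> nat \<Rightarrow> store \<Rightarrow> bool" where
  Skip: "exec Skip \<sigma> 1 \<sigma>"
| Assign: "exec (Assign i e) \<sigma> (1 + expr_time e) (\<sigma>(i := eval_expr e \<sigma>))"
| Seq: "exec c1 \<sigma> t1 \<sigma>' \<Longrightarrow> exec c2 \<sigma>' t2 \<sigma>'' \<Longrightarrow> exec (Seq c1 c2) \<sigma> (t1 + t2) \<sigma>''"
| IfTrue: "eval_expr e \<sigma> \<noteq> Leaf \<Longrightarrow> exec c1 \<sigma> t \<sigma>' \<Longrightarrow>
    exec (If e c1 c2) \<sigma> (1 + expr_time e + t) \<sigma>'"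
| IfFalse: "eval_expr e \<sigma> = Leaf \<Longrightarrow> exec c2 \<sigma> t \<sigma>' \<Longrightarrow>
    exec (If e c1 c2) \<sigma> (1 + expr_time e + t) \<sigma>'"
| WhileTrue: "eval_expr e \<sigma> \<noteq> Leaf \<Longrightarrow> exec c \<sigma> t1 \<sigma>' \<Longrightarrow> exec (While e c) \<sigma>' t2 \<sigma>'' \<Longrightarrow>
    exec (While e c) \<sigma> (1 + expr_time e + t1 + t2) \<sigma>''"
| WhileFalse: "eval_expr e \<sigma> = Leaf \<Longrightarrow> exec (While e c) \<sigma> (1 + expr_time e) \<sigma>"

inductive_cases SkipE: "exec Skip \<sigma> t \<sigma>'"
inductive_cases AssignE: "exec (Assign i e) \<sigma> t \<sigma>'"
inductive_cases SeqE: "exec (Seq c1 c2) \<sigma> t \<sigma>'"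
inductive_cases IfE: "exec (If e c1 c2) \<sigma> t \<sigma>'"
inductive_cases WhileE: "exec (While e c) \<sigma> t \<sigma>'"

lemma exec_deterministic:
  "exec c \<sigma> t \<sigma>1 \<Longrightarrow> exec c \<sigma> u \<sigma>2 \<Longrightarrow> t = u \<and> \<sigma>1 = \<sigma>2"
proof (induction arbitrary: u \<sigma>2 rule: exec.induct)
  case (Skip \<sigma>)
  from Skip.prems show ?case by (rule SkipE) simp
next
  case (Assign i e \<sigma>)
  from Assign.prems show ?case by (rule AssignE) simp
next
  case (Seq c1 \<sigma> t1 \<sigma>' c2 t2 \<sigma>'')
  from Seq.prems show ?case
  proof (rule SeqE)
    fix u1 \<tau> u2
    assume u: "u = u1 + u2" and 1: "exec c1 \<sigma> u1 \<tau>" and 2: "exec c2 \<tau> u2 \<sigma>2"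
    from Seq.IH(1)[OF 1] have "t1 = u1" "\<sigma>' = \<tau>" by simp_all
    moreover from Seq.IH(2)[OF 2[folded \<open>\<sigma>' = \<tau>\<close>]] have "t2 = u2" "\<sigma>'' = \<sigma>2" by simp_all
    ultimately show ?thesis using u by simp
  qed
next
  case (IfTrue e \<sigma> c1 t \<sigma>' c2)
  from IfTrue.prems show ?case by (rule IfE) (use IfTrue.hyps in \<open>auto dest: IfTrue.IH\<close>)
next
  case (IfFalse e \<sigma> c2 t \<sigma>' c1)
  from IfFalse.prems show ?case by (rule IfE) (use IfFalse.hyps in \<open>auto dest: IfFalse.IH\<close>)
next
  case (WhileTrue e \<sigma> c t1 \<sigma>' t2 \<sigma>'')
  from WhileTrue.prems show ?case
  proof (rule WhileE)
    fix u1 \<tau> u2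
    assume u: "u = Suc (expr_time e + u1 + u2)"
      and 1: "exec c \<sigma> u1 \<tau>" and 2: "exec (While e c) \<tau> u2 \<sigma>2"
    from WhileTrue.IH(1)[OF 1] have "t1 = u1" "\<sigma>' = \<tau>" by simp_all
    moreover from WhileTrue.IH(2)[OF 2[folded \<open>\<sigma>' = \<tau>\<close>]] have "t2 = u2" "\<sigma>'' = \<sigma>2" by simp_all
    ultimately show ?thesis using u by simp
  next
    assume "eval_expr e \<sigma> = Leaf"
    with WhileTrue.hyps(1) show ?thesis by contradiction
  qed
next
  case (WhileFalse e \<sigma> c)
  from WhileFalse.prems show ?case by (rule WhileE) (use WhileFalse.hyps in auto)
qed

text \<open>Variable 0 holds the input at the start and the output at the end.\<close>

definition runs :: "com \<Rightarrow> data \<Rightarrow> nat \<Rightarrow> data \<Rightarrow> bool" where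
  "runs p x t y \<longleftrightarrow> (\<exists>\<sigma>. exec p ((\<lambda>_. Leaf)(0 := x)) t \<sigma> \<and> \<sigma> 0 = y)"

primrec unary :: "nat \<Rightarrow> data" where
  "unary 0 = Leaf"
| "unary (Suc n) = Node Leaf (unary n)"

definition computable :: "(nat \<Rightarrow> nat) \<Rightarrow> bool" where
  "computable f \<longleftrightarrow> (\<exists>p. \<forall>n. \<exists>t. runs p (unary n) t (unary (f n)))"

section \<open>Fixed-parameter tractability\<close>

text \<open>
  An instance may have several encodings (the elements of a set can be listed in any order);
  an algorithm has to be correct on all of them.
\<close>

record 'i param_problem =
  instances :: "'i set"
  yes_instance :: "'i \<Rightarrow> bool"
  parameter :: "'i \<Rightarrow> nat"
  encodings :: "'i \<Rightarrow> data set"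

definition restrict_problem :: "'i param_problem \<Rightarrow> ('i \<Rightarrow> bool) \<Rightarrow> 'i param_problem" where
  "restrict_problem Q R = Q\<lparr>instances := {I \<in> instances Q. R I}\<rparr>"

definition fixed_parameter_tractable :: "'i param_problem \<Rightarrow> bool" where
  "fixed_parameter_tractable Q \<longleftrightarrow>
    (\<exists>p f c. computable f \<and>
      (\<forall>I \<in> instances Q. \<forall>x \<in> encodings Q I.
        \<exists>t y. runs p x t y \<and>
          t \<le> f (parameter Q I) * data_size x ^ c \<and>
          (y \<noteq> Leaf \<longleftrightarrow> yes_instance Q I)))"

section \<open>Encodings\<close>

fun bits :: "nat \<Rightarrow> bool list" where
  "bits n = (if n = 0 then [] else odd n # bits (n div 2))"

declare bits.simps [simp del]

primrec enc_list :: "('a \<Rightarrow> data) \<Rightarrow> 'a list \<Rightarrow> data" where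
  "enc_list enc [] = Leaf"
| "enc_list enc (a # as) = Node (enc a) (enc_list enc as)"

definition enc_bool :: "bool \<Rightarrow> data" where
  "enc_bool b = (if b then Node Leaf Leaf else Leaf)"

definition enc_nat :: "nat \<Rightarrow> data" where
  "enc_nat n = enc_list enc_bool (bits n)"

definition enc_int :: "int \<Rightarrow> data" where
  "enc_int z = Node (enc_bool (z < 0)) (enc_nat (nat \<bar>z\<bar>))"

definition enc_pair :: "('a \<Rightarrow> data) \<Rightarrow> ('b \<Rightarrow> data) \<Rightarrow> 'a \<times> 'b \<Rightarrow> data" where
  "enc_pair enc1 enc2 = (\<lambda>(a, b). Node (enc1 a) (enc2 b))"

definition enc_set :: "('a \<Rightarrow> data) \<Rightarrow> 'a set \<Rightarrow> data set" where
  "enc_set enc A = {enc_list enc as |as. distinct as \<and> set as = A}"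

section \<open>The problem MD-SPP\<close>

definition transitive_closure :: "'a pair_pre_digraph \<Rightarrow> 'a pair_pre_digraph" where
  "transitive_closure D = \<lparr>pverts = pverts D, parcs = (parcs D)\<^sup>+\<rparr>"

text \<open>Directed paths are given by their vertex sequences; \<open>[s]\<close> is the path from \<open>s\<close> to \<open>s\<close>.\<close>

definition dipath :: "'a pair_pre_digraph \<Rightarrow> 'a \<Rightarrow> 'a list \<Rightarrow> 'a \<Rightarrow> bool" where
  "dipath D s P t \<longleftrightarrow> vpath P (with_proj D) \<and> hd P = s \<and> last P = t"

definition path_digraph :: "'a list \<Rightarrow> 'a pair_pre_digraph" where
  "path_digraph P = \<lparr>pverts = set P, parcs = set (vwalk_arcs P)\<rparr>"

definition digraph_inter ::
    "'a pair_pre_digraph \<Rightarrow> 'a pair_pre_digraph \<Rightarrow> 'a pair_pre_digraph" where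
  "digraph_inter G H = \<lparr>pverts = pverts G \<inter> pverts H, parcs = parcs G \<inter> parcs H\<rparr>"

text \<open>The maximum outdegree of the digraph without vertices is 0.\<close>

definition max_out_degree :: "'a pair_pre_digraph \<Rightarrow> nat" where
  "max_out_degree H = Max (insert 0 (out_degree (with_proj H) ` pverts H))"

text \<open>
  Loops of the transitive closure (at vertices on directed cycles of \<open>D\<close>) are immaterial
  below; all other arcs join the end vertices of directed paths.
\<close>

lemma transitive_closure_arc_iff:
  assumes "pair_wf_digraph D" and "u \<noteq> v"
  shows "(u, v) \<in> parcs (transitive_closure D) \<longleftrightarrow> (\<exists>P. dipath D u P v)"
proof
  interpret pair_wf_digraph D by fact
  assume "(u, v) \<in> parcs (transitive_closure D)"
  then have "(u, v) \<in> (parcs D)\<^sup>+" by (simp add: transitive_closure_def)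
  then have "\<exists>p. vwalk p (with_proj D) \<and> hd p = u \<and> last p = v"
  proof (induction rule: converse_trancl_induct)
    case (base y)
    then have "vwalk [y, v] (with_proj D)" by (auto simp: vwalk_def dest: in_arcsD1 in_arcsD2)
    then show ?case by (intro exI[of _ "[y, v]"]) simp
  next
    case (step y z)
    then obtain p where p: "vwalk p (with_proj D)" "hd p = z" "last p = v" by blast
    then have "vwalk (y # p) (with_proj D)"
      using step.hyps(1) by (intro vwalk_consI) (auto dest: in_arcsD1)
    moreover have "p \<noteq> []" using p(1) by (simp add: vwalk_def)
    ultimately show ?case using p(3) by (intro exI[of _ "y # p"]) simp
  qed
  then obtain p where "vwalk p (with_proj D)" "hd p = u" "last p = v" by blast
  then show "\<exists>P. dipath D u P v"
    unfolding dipath_def by (rule vwalk_imp_ex_vpath)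
next
  assume "\<exists>P. dipath D u P v"
  then obtain P where "vwalk P (with_proj D)" "hd P = u" "last P = v"
    by (auto simp: dipath_def)
  then have "(u, v) \<in> (parcs D)\<^sup>*"
  proof (induction P arbitrary: u rule: vwalk_induct)
    case (Base w)
    then show ?case by simp
  next
    case (Cons w x ws)
    then have "(x, v) \<in> (parcs D)\<^sup>*" by simp
    with Cons.hyps(1) Cons.prems(1) show ?case
      by (simp add: converse_rtrancl_into_rtrancl)
  qed
  with \<open>u \<noteq> v\<close> show "(u, v) \<in> parcs (transitive_closure D)"
    by (auto simp: transitive_closure_def rtrancl_eq_or_trancl)
qed

record md_spp_instance =
  base_digraph :: "nat pair_pre_digraph"
  target :: int
  commodities :: "(nat \<times> nat \<times> nat list) set"

definition md_spp_valid :: "md_spp_instance \<Rightarrow> bool" where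
  "md_spp_valid I \<longleftrightarrow>
    pair_fin_digraph (base_digraph I) \<and>
    finite (commodities I) \<and>
    (\<forall>(s, t, P) \<in> commodities I. dipath (base_digraph I) s P t)"

definition md_spp_solvable :: "md_spp_instance \<Rightarrow> bool" where
  "md_spp_solvable I \<longleftrightarrow>
    (\<exists>H. subgraph (with_proj H) (with_proj (transitive_closure (base_digraph I))) \<and>
      int (max_out_degree H) \<le> target I \<and>
      (\<forall>(s, t, P) \<in> commodities I.
        \<exists>q. dipath (digraph_inter H (transitive_closure (path_digraph P))) s q t))"

definition md_spp_encodings :: "md_spp_instance \<Rightarrow> data set" where
  "md_spp_encodings I =
    {Node (Node vs as) (Node (enc_int (target I)) ks) |vs as ks.
      vs \<in> enc_set enc_nat (pverts (base_digraph I)) \<and>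
      as \<in> enc_set (enc_pair enc_nat enc_nat) (parcs (base_digraph I)) \<and>
      ks \<in> enc_set (enc_pair enc_nat (enc_pair enc_nat (enc_list enc_nat))) (commodities I)}"

definition md_spp :: "md_spp_instance param_problem" where
  "md_spp =
    \<lparr>instances = {I. md_spp_valid I},
     yes_instance = md_spp_solvable,
     parameter = (\<lambda>I. card (commodities I)),
     encodings = md_spp_encodings\<rparr>"

end

theory Submission
  imports Defs "HOL-Library.Sublist"
begin

text \<open>
  Let \<open>T = 1\<close>. In a solution every vertex has at most one outgoing arc, so all routes through a vertex
  that is not an end of a commodity continue with the same arc and can bypass the vertex. Hence a
  solution may be assumed to be a partial map from the at most \<open>2k\<close> ends of commodities to themselves, and
  all \<open>(2k)^(2k)\<close> of these maps can be tried. A map \<open>g\<close> routes \<open>(s, t, P)\<close> iff the orbit of \<open>s\<close>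
  under \<open>g\<close> has an initial part that is a subsequence of \<open>P\<close> and ends in \<open>t\<close>; a single
  greedy scan of \<open>P\<close> decides this. For \<open>T = 0\<close> the identity is the only map to be tried.
\<close>

section \<open>Functions computed by WHILE programs\<close>

text \<open>A vertex occurs only once in P, so an arc of T(P) points forward in P and the paths in
  T(P) are the nonempty subsequences of P. Their arcs lie in T(D) automatically, so the algorithm
  only reads the target and the commodities. Bypassing replaces the out-arc map of a solution by its
  first return map to the set of ends (\<open>return_map\<close>). Conversely, every map g defines a
  subgraph of T(D) of outdegree at most 1, by keeping those arcs (u, g u) that T(D) contains; hence
  a candidate needs no test beyond the routing. In the time analysis many costs are measured by the
  number of list entries instead of the size of trees: subtrees are shared, so extending a partial
  map takes constant time however large its entries are.\<close>

primrec written :: "com \<Rightarrow> nat set" where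
  "written Skip = {}"
| "written (Assign i e) = {i}"
| "written (Seq c1 c2) = written c1 \<union> written c2"
| "written (If e c1 c2) = written c1 \<union> written c2"
| "written (While e c) = written c"

lemma finite_written: "finite (written c)"
  by (induction c) auto

lemma exec_unwritten: "exec c \<sigma> t \<sigma>' \<Longrightarrow> i \<notin> written c \<Longrightarrow> \<sigma>' i = \<sigma> i"
  by (induction rule: exec.induct) auto

lemma fresh_variable:
  assumes "finite (A :: nat set)"
  obtains n where "n \<notin> A"
  using assms ex_new_if_finite infinite_UNIV_nat by blast

lemma exec_Assign:
  assumes "t = 1 + expr_time e" and "\<sigma>' = \<sigma>(i := eval_expr e \<sigma>)"
  shows "exec (Assign i e) \<sigma> t \<sigma>'"
  using assms exec.Assign by simp

text \<open>
  Programs may leave garbage in all variables except 0, and are required to work in the presence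
  of such garbage; this is what makes them composable.
\<close>

definition realizes :: "com \<Rightarrow> (data \<Rightarrow> data) \<Rightarrow> (data \<Rightarrow> nat) \<Rightarrow> bool" where
  "realizes p F T \<longleftrightarrow> (\<forall>\<sigma>. \<exists>t \<sigma>'. exec p \<sigma> t \<sigma>' \<and> \<sigma>' 0 = F (\<sigma> 0) \<and> t \<le> T (\<sigma> 0))"

text \<open>\<open>Suc\<close> makes \<open>T = 0\<close> mean constant time, and \<open>C\<close>
  hides the cost of elementary operations, so later bounds only have to be right up to a constant
  factor.\<close>

definition computes_in :: "(data \<Rightarrow> data) \<Rightarrow> (data \<Rightarrow> nat) \<Rightarrow> bool" where
  "computes_in F T \<longleftrightarrow> (\<exists>p C. realizes p F (\<lambda>x. C * Suc (T x)))"

lemma realizesE: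
  assumes "realizes p F T"
  obtains t \<sigma>' where "exec p \<sigma> t \<sigma>'" "\<sigma>' 0 = F (\<sigma> 0)" "t \<le> T (\<sigma> 0)"
    "\<And>i. i \<notin> written p \<Longrightarrow> \<sigma>' i = \<sigma> i"
  using assms exec_unwritten unfolding realizes_def by metis

lemma computes_inI:
  assumes "\<And>\<sigma>. \<exists>t \<sigma>'. exec p \<sigma> t \<sigma>' \<and> \<sigma>' 0 = F (\<sigma> 0) \<and> t \<le> C * Suc (T (\<sigma> 0))"
  shows "computes_in F T"
  using assms unfolding computes_in_def realizes_def by blast

lemma computes_in_weaken:
  assumes "computes_in F T" and le: "\<And>x. T x \<le> C * Suc (T' x)"
  shows "computes_in F T'"
proof -
  from assms(1) obtain p D where p: "realizes p F (\<lambda>x. D * Suc (T x))"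
    unfolding computes_in_def by blast
  have "D * Suc (T x) \<le> (D * Suc C) * Suc (T' x)" for x
    using le[of x] by (metis Suc_le_mono add_Suc mult.assoc mult_Suc mult_le_mono2 add_mono
        le_add1 trans_le_add1 plus_1_eq_Suc)
  with p have "realizes p F (\<lambda>x. (D * Suc C) * Suc (T' x))"
    unfolding realizes_def by (meson order_trans)
  then show ?thesis unfolding computes_in_def by blast
qed

text \<open>Sizes of intermediate results are not tracked; the hypothesis on \<open>U (F x)\<close>
  is where each use bounds the second stage in terms of the original input.\<close>

lemma computes_in_comp:
  assumes "computes_in F T" and "computes_in G U"
    and le: "\<And>x. U (F x) \<le> C * Suc (T x)"
  shows "computes_in (\<lambda>x. G (F x)) T"
proof -
  from assms(1) obtain p D where p: "realizes p F (\<lambda>x. D * Suc (T x))"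
    unfolding computes_in_def by blast
  from assms(2) obtain q E where q: "realizes q G (\<lambda>x. E * Suc (U x))"
    unfolding computes_in_def by blast
  show ?thesis
  proof (rule computes_inI)
    fix \<sigma>
    obtain t1 \<sigma>1 where 1: "exec p \<sigma> t1 \<sigma>1" "\<sigma>1 0 = F (\<sigma> 0)" "t1 \<le> D * Suc (T (\<sigma> 0))"
      using realizesE[OF p] by metis
    obtain t2 \<sigma>2 where 2: "exec q \<sigma>1 t2 \<sigma>2" "\<sigma>2 0 = G (\<sigma>1 0)" "t2 \<le> E * Suc (U (\<sigma>1 0))"
      using realizesE[OF q] by metis
    have "E * Suc (U (F (\<sigma> 0))) \<le> E * (Suc C * Suc (T (\<sigma> 0)))"
      using le[of "\<sigma> 0"] by (intro mult_le_mono2) simp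
    then have "t1 + t2 \<le> (D + E * Suc C) * Suc (T (\<sigma> 0))"
      using 1(2,3) 2(3) by (simp only: add_mult_distrib mult.assoc)
    with 1 2 exec.Seq show "\<exists>t \<sigma>'. exec (Seq p q) \<sigma> t \<sigma>' \<and> \<sigma>' 0 = G (F (\<sigma> 0)) \<and>
        t \<le> (D + E * Suc C) * Suc (T (\<sigma> 0))"
      by metis
  qed
qed

lemma computes_in_expr:
  assumes "\<And>\<sigma>. eval_expr e \<sigma> = F (\<sigma> 0)"
  shows "computes_in F T"
proof (rule computes_inI)
  fix \<sigma> :: store
  show "\<exists>t \<sigma>'. exec (Assign 0 e) \<sigma> t \<sigma>' \<and> \<sigma>' 0 = F (\<sigma> 0) \<and> t \<le> (1 + expr_time e) * Suc (T (\<sigma> 0))"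
    by (intro exI conjI, rule exec.Assign) (auto simp: assms)
qed

lemma computes_in_id: "computes_in (\<lambda>x. x) T"
  by (rule computes_in_expr[of "EVar 0"]) simp

lemma computes_in_const: "computes_in (\<lambda>x. d) T"
proof -
  obtain e where "\<And>\<sigma>. eval_expr e \<sigma> = d"
  proof (induction d arbitrary: thesis)
    case Leaf
    then show ?case using eval_expr.simps(2) by blast
  next
    case (Node a b)
    then show ?case using eval_expr.simps(3) by metis
  qed
  then show ?thesis by (rule computes_in_expr)
qed

lemma computes_in_left:
  assumes "computes_in F T"
  shows "computes_in (\<lambda>x. left (F x)) T"
  by (rule computes_in_comp[OF assms, of _ "\<lambda>_. 0" 0], rule computes_in_expr[of "ELeft (EVar 0)"]) auto

lemma computes_in_right:
  assumes "computes_in F T"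
  shows "computes_in (\<lambda>x. right (F x)) T"
  by (rule computes_in_comp[OF assms, of _ "\<lambda>_. 0" 0], rule computes_in_expr[of "ERight (EVar 0)"]) auto

lemma computes_in_Node:
  assumes "computes_in F T" and "computes_in G T"
  shows "computes_in (\<lambda>x. Node (F x) (G x)) T"
proof -
  from assms(1) obtain p C where p: "realizes p F (\<lambda>x. C * Suc (T x))"
    unfolding computes_in_def by blast
  from assms(2) obtain q D where q: "realizes q G (\<lambda>x. D * Suc (T x))"
    unfolding computes_in_def by blast
  obtain n where n: "n \<notin> insert 0 (written p \<union> written q)"
    using fresh_variable finite_written by (meson finite.insertI finite_UnI)
  obtain m where m: "m \<notin> insert n (insert 0 (written p \<union> written q))"
    using fresh_variable finite_written by (meson finite.insertI finite_UnI)
  \<comment> \<open>Both programs read and write variable 0. The input waits in \<open>n\<close>,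
    which \<open>p\<close> leaves alone, and the first result in \<open>m\<close>, which
    \<open>q\<close> leaves alone.\<close>
  let ?c = "Seq (Assign n (EVar 0)) (Seq p (Seq (Assign m (EVar 0)) (Seq (Assign 0 (EVar n))
    (Seq q (Assign 0 (ENode (EVar m) (EVar 0)))))))"
  show ?thesis
  proof (rule computes_inI)
    fix \<sigma>
    obtain t1 \<sigma>1 where 1: "exec p (\<sigma>(n := \<sigma> 0)) t1 \<sigma>1" "\<sigma>1 0 = F (\<sigma> 0)"
      "t1 \<le> C * Suc (T (\<sigma> 0))" "\<sigma>1 n = \<sigma> 0"
      using realizesE[OF p, of "\<sigma>(n := \<sigma> 0)"] n by (metis fun_upd_other fun_upd_same insert_iff UnI1)
    define \<sigma>2 where "\<sigma>2 = \<sigma>1(m := F (\<sigma> 0), 0 := \<sigma> 0)"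
    obtain t2 \<sigma>3 where 2: "exec q \<sigma>2 t2 \<sigma>3" "\<sigma>3 0 = G (\<sigma> 0)"
      "t2 \<le> D * Suc (T (\<sigma> 0))" "\<sigma>3 m = F (\<sigma> 0)"
      using realizesE[OF q, of \<sigma>2] m unfolding \<sigma>2_def
      by (metis fun_upd_other fun_upd_same insert_iff UnI2)
    have a: "exec (Assign n (EVar 0)) \<sigma> 2 (\<sigma>(n := \<sigma> 0))"
      by (intro exec_Assign) simp_all
    have b: "exec (Assign m (EVar 0)) \<sigma>1 2 (\<sigma>1(m := F (\<sigma> 0)))"
      using 1(2) by (intro exec_Assign) simp_all
    have c: "exec (Assign 0 (EVar n)) (\<sigma>1(m := F (\<sigma> 0))) 2 \<sigma>2"
      using 1(4) m n
      by (intro exec_Assign) (simp_all add: \<sigma>2_def)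
    have d: "exec (Assign 0 (ENode (EVar m) (EVar 0))) \<sigma>3 4 (\<sigma>3(0 := Node (F (\<sigma> 0)) (G (\<sigma> 0))))"
      using 2 by (intro exec_Assign) simp_all
    have "exec ?c \<sigma> (2 + (t1 + (2 + (2 + (t2 + 4))))) (\<sigma>3(0 := Node (F (\<sigma> 0)) (G (\<sigma> 0))))"
      by (intro exec.Seq) (use a 1(1) b c 2(1) d in auto)
    moreover have "2 + (t1 + (2 + (2 + (t2 + 4)))) \<le> (C + D + 10) * Suc (T (\<sigma> 0))"
      using 1(3) 2(3) by (simp add: add_mult_distrib)
    ultimately show "\<exists>t \<sigma>'. exec ?c \<sigma> t \<sigma>' \<and> \<sigma>' 0 = Node (F (\<sigma> 0)) (G (\<sigma> 0)) \<and>
        t \<le> (C + D + 10) * Suc (T (\<sigma> 0))"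
      by (metis fun_upd_same)
  qed
qed

lemma computes_in_comp2:
  assumes "computes_in A T" and "computes_in B T"
    and "computes_in (\<lambda>z. G (left z) (right z)) (\<lambda>z. U (left z) (right z))"
    and "\<And>x. U (A x) (B x) \<le> C * Suc (T x)"
  shows "computes_in (\<lambda>x. G (A x) (B x)) T"
  using computes_in_comp[OF computes_in_Node[OF assms(1,2)] assms(3), of C] assms(4) by simp

lemma computes_in_If_Leaf:
  assumes "computes_in P T" and "computes_in F T" and "computes_in G T"
  shows "computes_in (\<lambda>x. if P x \<noteq> Leaf then F x else G x) T"
proof -
  from assms(2) obtain p C where p: "realizes p F (\<lambda>x. C * Suc (T x))"
    unfolding computes_in_def by blast
  from assms(3) obtain q D where q: "realizes q G (\<lambda>x. D * Suc (T x))"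
    unfolding computes_in_def by blast
  \<comment> \<open>Computing \<open>P\<close> overwrites the input, so its value is paired with a
    copy of the input, on which the chosen branch then runs.\<close>
  have "computes_in (\<lambda>z. if left z \<noteq> Leaf then F (right z) else G (right z)) (\<lambda>z. T (right z))"
  proof (rule computes_inI)
    fix \<sigma> :: store
    let ?c = "If (ELeft (EVar 0)) (Seq (Assign 0 (ERight (EVar 0))) p) (Seq (Assign 0 (ERight (EVar 0))) q)"
    define \<sigma>1 where "\<sigma>1 = \<sigma>(0 := right (\<sigma> 0))"
    have a: "exec (Assign 0 (ERight (EVar 0))) \<sigma> 3 \<sigma>1"
      by (intro exec_Assign) (simp_all add: \<sigma>1_def numeral_3_eq_3)
    obtain t1 \<tau>1 where 1: "exec p \<sigma>1 t1 \<tau>1" "\<tau>1 0 = F (\<sigma>1 0)" "t1 \<le> C * Suc (T (\<sigma>1 0))"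
      using realizesE[OF p] by metis
    obtain t2 \<tau>2 where 2: "exec q \<sigma>1 t2 \<tau>2" "\<tau>2 0 = G (\<sigma>1 0)" "t2 \<le> D * Suc (T (\<sigma>1 0))"
      using realizesE[OF q] by metis
    show "\<exists>t \<sigma>'. exec ?c \<sigma> t \<sigma>' \<and>
        \<sigma>' 0 = (if left (\<sigma> 0) \<noteq> Leaf then F (right (\<sigma> 0)) else G (right (\<sigma> 0))) \<and>
        t \<le> (C + D + 6) * Suc (T (right (\<sigma> 0)))"
    proof (cases "left (\<sigma> 0) = Leaf")
      case True
      then have "exec ?c \<sigma> (1 + expr_time (ELeft (EVar 0)) + (3 + t2)) \<tau>2"
        by (intro exec.IfFalse exec.Seq[OF a] 2(1)) simp
      then show ?thesis using True 2(2,3)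
        by (intro exI[of _ "1 + expr_time (ELeft (EVar 0)) + (3 + t2)"] exI[of _ \<tau>2])
          (simp add: \<sigma>1_def add_mult_distrib)
    next
      case False
      then have "exec ?c \<sigma> (1 + expr_time (ELeft (EVar 0)) + (3 + t1)) \<tau>1"
        by (intro exec.IfTrue exec.Seq[OF a] 1(1)) simp
      then show ?thesis using False 1(2,3)
        by (intro exI[of _ "1 + expr_time (ELeft (EVar 0)) + (3 + t1)"] exI[of _ \<tau>1])
          (simp add: \<sigma>1_def add_mult_distrib)
    qed
  qed
  from computes_in_comp[OF computes_in_Node[OF assms(1) computes_in_id] this, of 1]
  show ?thesis unfolding left.simps right.simps by simp
qed

section \<open>Loops over lists and their cost\<close>

primrec elems :: "data \<Rightarrow> data list" where
  "elems Leaf = []"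
| "elems (Node a b) = a # elems b"

lemma elems_enc_list: "elems (enc_list f xs) = map f xs"
  by (induction xs) auto

text \<open>The cost of a step may depend on the accumulator. This matters for
  \<open>assignments\<close>, whose accumulator grows from round to round. The \<open>Suc\<close>
  pays for the loop overhead.\<close>

primrec fold_time :: "(data \<Rightarrow> data \<Rightarrow> nat) \<Rightarrow> (data \<Rightarrow> data \<Rightarrow> data) \<Rightarrow> data \<Rightarrow> data list \<Rightarrow> nat" where
  "fold_time \<tau> s r [] = 0"
| "fold_time \<tau> s r (a # as) = Suc (\<tau> r a) + fold_time \<tau> s (s r a) as"

lemma computes_in_foldl:
  assumes S: "computes_in (\<lambda>z. S (left z) (left (right z)) (right (right z))) \<tau>"
    and A: "computes_in A T" and L: "computes_in L T"
    and le: "\<And>x. fold_time (\<lambda>r a. \<tau> (Node x (Node r a))) (S x) (A x) (elems (L x)) \<le> C * Suc (T x)"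
  shows "computes_in (\<lambda>x. foldl (S x) (A x) (elems (L x))) T"
proof -
  from S obtain p D where
    p: "realizes p (\<lambda>z. S (left z) (left (right z)) (right (right z))) (\<lambda>x. D * Suc (\<tau> x))"
    unfolding computes_in_def by blast
  obtain e where e: "e \<notin> insert 0 (written p)"
    using fresh_variable finite_written by (metis finite.insertI)
  obtain r where r: "r \<notin> insert e (insert 0 (written p))"
    using fresh_variable finite_written by (metis finite.insertI)
  obtain l where l: "l \<notin> insert r (insert e (insert 0 (written p)))"
    using fresh_variable finite_written by (metis finite.insertI)
  let ?b1 = "Assign 0 (ENode (EVar e) (ENode (EVar r) (ELeft (EVar l))))"
  let ?b2 = "Assign r (EVar 0)"
  let ?b3 = "Assign l (ERight (EVar l))"
  let ?body = "Seq ?b1 (Seq p (Seq ?b2 ?b3))"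
  let ?loop = "While (EVar l) ?body"
  \<comment> \<open>One round costs 2 for the test and 7, 2, 3 for the assignments around
    \<open>p\<close>, in total 14; the leading 2 is the final failing test.\<close>
  have loop: "\<exists>t \<sigma>'. exec ?loop \<sigma> t \<sigma>' \<and> \<sigma>' r = foldl (S x) a (elems ds) \<and>
      t \<le> 2 + (D + 14) * fold_time (\<lambda>r a. \<tau> (Node x (Node r a))) (S x) a (elems ds)"
    if "\<sigma> e = x" "\<sigma> r = a" "\<sigma> l = ds" for \<sigma> x a ds
    using that
  proof (induction ds arbitrary: \<sigma> a)
    case Leaf
    then have "exec ?loop \<sigma> (1 + expr_time (EVar l)) \<sigma>" by (intro exec.WhileFalse) simp
    then show ?case using Leaf by (intro exI[of _ 2] exI[of _ \<sigma>]) (simp add: numeral_2_eq_2)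
  next
    case (Node d ds)
    let ?z = "Node x (Node a d)"
    define \<sigma>1 where "\<sigma>1 = \<sigma>(0 := ?z)"
    obtain t \<sigma>2 where 2: "exec p \<sigma>1 t \<sigma>2" "\<sigma>2 0 = S x a d" "t \<le> D * Suc (\<tau> ?z)"
        "\<And>i. i \<notin> written p \<Longrightarrow> \<sigma>2 i = \<sigma>1 i"
      by (rule realizesE[OF p, of \<sigma>1]) (simp add: \<sigma>1_def)
    define \<sigma>3 where "\<sigma>3 = \<sigma>2(r := S x a d)"
    define \<sigma>4 where "\<sigma>4 = \<sigma>3(l := ds)"
    have l3: "\<sigma>3 l = Node d ds" using 2(4)[of l] l Node.prems by (simp add: \<sigma>3_def \<sigma>1_def)
    have "exec ?b1 \<sigma> 7 \<sigma>1"
      using Node.prems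
      by (intro exec_Assign) (simp_all add: \<sigma>1_def)
    moreover have "exec ?b2 \<sigma>2 2 \<sigma>3"
      using 2(2)
      by (intro exec_Assign) (simp_all add: \<sigma>3_def)
    moreover have "exec ?b3 \<sigma>3 3 \<sigma>4"
      using l3
      by (intro exec_Assign) (simp_all add: \<sigma>4_def numeral_3_eq_3)
    ultimately have body: "exec ?body \<sigma> (7 + (t + (2 + 3))) \<sigma>4"
      using 2(1) by (blast intro: exec.Seq)
    have "\<sigma>4 e = x" "\<sigma>4 r = S x a d" "\<sigma>4 l = ds"
      using 2(4)[of e] l r e Node.prems by (auto simp: \<sigma>4_def \<sigma>3_def \<sigma>1_def)
    then obtain u \<sigma>5 where 5: "exec ?loop \<sigma>4 u \<sigma>5" "\<sigma>5 r = foldl (S x) (S x a d) (elems ds)"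
        "u \<le> 2 + (D + 14) * fold_time (\<lambda>r a. \<tau> (Node x (Node r a))) (S x) (S x a d) (elems ds)"
      using Node.IH(2) by blast
    have "exec ?loop \<sigma> (1 + expr_time (EVar l) + (7 + (t + (2 + 3))) + u) \<sigma>5"
      using Node.prems by (intro exec.WhileTrue[OF _ body 5(1)]) simp
    moreover have "1 + expr_time (EVar l) + (7 + (t + (2 + 3))) + u \<le>
        2 + (D + 14) * fold_time (\<lambda>r a. \<tau> (Node x (Node r a))) (S x) a (elems (Node d ds))"
    proof -
      have "14 + t \<le> (D + 14) * Suc (\<tau> ?z)" using 2(3) by (simp add: add_mult_distrib)
      with 5(3) 2(3) show ?thesis by (simp add: add_mult_distrib add_mult_distrib2)
    qed
    moreover have "\<sigma>5 r = foldl (S x) a (elems (Node d ds))" using 5(2) by simp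
    ultimately show ?case by blast
  qed
  have "computes_in (\<lambda>z. foldl (S (left z)) (left (right z)) (elems (right (right z))))
    (\<lambda>z. fold_time (\<lambda>r a. \<tau> (Node (left z) (Node r a))) (S (left z)) (left (right z)) (elems (right (right z))))"
  proof (rule computes_inI)
    fix \<sigma> :: store
    let ?z = "\<sigma> 0"
    let ?i1 = "Assign e (ELeft (EVar 0))"
    let ?i2 = "Assign r (ELeft (ERight (EVar 0)))"
    let ?i3 = "Assign l (ERight (ERight (EVar 0)))"
    let ?o = "Assign 0 (EVar r)"
    let ?c = "Seq ?i1 (Seq ?i2 (Seq ?i3 (Seq ?loop ?o)))"
    define \<sigma>1 where "\<sigma>1 = \<sigma>(e := left ?z)"
    define \<sigma>2 where "\<sigma>2 = \<sigma>1(r := left (right ?z))"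
    define \<sigma>3 where "\<sigma>3 = \<sigma>2(l := right (right ?z))"
    let ?t = "fold_time (\<lambda>r a. \<tau> (Node (left ?z) (Node r a))) (S (left ?z)) (left (right ?z)) (elems (right (right ?z)))"
    have "\<sigma>3 e = left ?z" "\<sigma>3 r = left (right ?z)" "\<sigma>3 l = right (right ?z)"
      using e r l by (auto simp: \<sigma>3_def \<sigma>2_def \<sigma>1_def)
    from loop[OF this] obtain t \<sigma>4 where 4: "exec ?loop \<sigma>3 t \<sigma>4"
      "\<sigma>4 r = foldl (S (left ?z)) (left (right ?z)) (elems (right (right ?z)))"
      "t \<le> 2 + (D + 14) * ?t" by blast
    have "exec ?i1 \<sigma> 3 \<sigma>1"
      by (intro exec_Assign) (simp_all add: \<sigma>1_def numeral_3_eq_3)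
    moreover have "exec ?i2 \<sigma>1 4 \<sigma>2"
      using e
      by (intro exec_Assign) (simp_all add: \<sigma>1_def \<sigma>2_def eval_nat_numeral)
    moreover have "exec ?i3 \<sigma>2 4 \<sigma>3"
      using e r
      by (intro exec_Assign) (simp_all add: \<sigma>1_def \<sigma>2_def \<sigma>3_def eval_nat_numeral)
    moreover have "exec ?o \<sigma>4 2 (\<sigma>4(0 := \<sigma>4 r))"
      by (intro exec_Assign) simp_all
    ultimately have "exec ?c \<sigma> (3 + (4 + (4 + (t + 2)))) (\<sigma>4(0 := \<sigma>4 r))"
      using 4(1) by (blast intro: exec.Seq)
    moreover have "3 + (4 + (4 + (t + 2))) \<le> (D + 16) * Suc ?t"
      using 4(3) by (simp add: add_mult_distrib)
    ultimately show "\<exists>t \<sigma>'. exec ?c \<sigma> t \<sigma>' \<and>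
        \<sigma>' 0 = foldl (S (left ?z)) (left (right ?z)) (elems (right (right ?z))) \<and>
        t \<le> (D + 16) * Suc ?t"
      using 4(2) by (metis fun_upd_same)
  qed
  from computes_in_comp[OF computes_in_Node[OF computes_in_id computes_in_Node[OF A L]] this, of C] le
  show ?thesis by simp
qed

section \<open>Boolean tests and bounded quantifiers\<close>

lemma computes_in_If:
  assumes "computes_in (\<lambda>x. enc_bool (P x)) T" and "computes_in F T" and "computes_in G T"
  shows "computes_in (\<lambda>x. if P x then F x else G x) T"
proof -
  have "(enc_bool (P x) \<noteq> Leaf) = P x" for x by (simp add: enc_bool_def)
  then show ?thesis using computes_in_If_Leaf[OF assms] by presburger
qed

lemma computes_in_enc_bool_comp2:
  assumes "computes_in A T" and "computes_in B T"
    and "computes_in (\<lambda>z. enc_bool (P (left z) (right z))) (\<lambda>z. U (left z) (right z))"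
    and "\<And>x. U (A x) (B x) \<le> C * Suc (T x)"
  shows "computes_in (\<lambda>x. enc_bool (P (A x) (B x))) T"
  using computes_in_comp2[OF assms(1,2), of "\<lambda>a b. enc_bool (P a b)"] assms(3,4) .

lemma computes_in_enc_bool_neq_Leaf:
  assumes "computes_in F T"
  shows "computes_in (\<lambda>x. enc_bool (F x \<noteq> Leaf)) T"
  using computes_in_If_Leaf[OF assms computes_in_const computes_in_const]
  unfolding enc_bool_def .

lemma computes_in_enc_bool_eq_Leaf:
  assumes "computes_in F T"
  shows "computes_in (\<lambda>x. enc_bool (F x = Leaf)) T"
proof -
  have "(\<lambda>x. enc_bool (F x = Leaf)) = (\<lambda>x. if F x \<noteq> Leaf then enc_bool False else enc_bool True)" by auto
  then show ?thesis using computes_in_If_Leaf[OF assms computes_in_const computes_in_const] by metis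
qed

lemma computes_in_enc_bool_not:
  assumes "computes_in (\<lambda>x. enc_bool (P x)) T"
  shows "computes_in (\<lambda>x. enc_bool (\<not> P x)) T"
proof -
  have "(\<lambda>x. enc_bool (\<not> P x)) = (\<lambda>x. if P x then enc_bool False else enc_bool True)" by auto
  then show ?thesis using computes_in_If[OF assms computes_in_const computes_in_const] by metis
qed

lemma computes_in_enc_bool_conj:
  assumes "computes_in (\<lambda>x. enc_bool (P x)) T" and "computes_in (\<lambda>x. enc_bool (Q x)) T"
  shows "computes_in (\<lambda>x. enc_bool (P x \<and> Q x)) T"
proof -
  have "(\<lambda>x. enc_bool (P x \<and> Q x)) = (\<lambda>x. if P x then enc_bool (Q x) else enc_bool False)" by auto
  then show ?thesis using computes_in_If[OF assms computes_in_const] by metis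
qed

lemma computes_in_enc_bool_iff:
  assumes "computes_in (\<lambda>x. enc_bool (P x)) T" and "computes_in (\<lambda>x. enc_bool (Q x)) T"
  shows "computes_in (\<lambda>x. enc_bool (P x \<longleftrightarrow> Q x)) T"
proof -
  have "(\<lambda>x. enc_bool (P x \<longleftrightarrow> Q x)) = (\<lambda>x. if P x then enc_bool (Q x) else enc_bool (\<not> Q x))" by auto
  then show ?thesis
    using computes_in_If[OF assms(1,2) computes_in_enc_bool_not[OF assms(2)]] by metis
qed

lemmas computes_in_intros = computes_in_id computes_in_const computes_in_left computes_in_right
  computes_in_Node computes_in_If computes_in_enc_bool_neq_Leaf computes_in_enc_bool_eq_Leaf computes_in_enc_bool_not
  computes_in_enc_bool_conj computes_in_enc_bool_iff

lemma fold_time_le: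
  assumes "\<And>r a. a \<in> set as \<Longrightarrow> \<tau> r a \<le> h a"
  shows "fold_time \<tau> s r as \<le> (\<Sum>a\<leftarrow>as. Suc (h a))"
  using assms
proof (induction as arbitrary: r)
  case (Cons a as)
  have "fold_time \<tau> s (s r a) as \<le> (\<Sum>a\<leftarrow>as. Suc (h a))"
    by (rule Cons.IH) (use Cons.prems in auto)
  moreover have "\<tau> r a \<le> h a" using Cons.prems by auto
  ultimately show ?case by simp
qed simp

lemma computes_in_foldl_sum:
  assumes "computes_in (\<lambda>z. S (left z) (left (right z)) (right (right z))) \<tau>"
    and "computes_in A T" and "computes_in L T"
    and "\<And>x r a. a \<in> set (elems (L x)) \<Longrightarrow> \<tau> (Node x (Node r a)) \<le> h x a"
    and "\<And>x. (\<Sum>a\<leftarrow>elems (L x). Suc (h x a)) \<le> C * Suc (T x)"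
  shows "computes_in (\<lambda>x. foldl (S x) (A x) (elems (L x))) T"
proof (rule computes_in_foldl[OF assms(1-3)])
  show "fold_time (\<lambda>r a. \<tau> (Node x (Node r a))) (S x) (A x) (elems (L x)) \<le> C * Suc (T x)" for x
    by (rule order_trans[OF fold_time_le assms(5)]) (use assms(4) in auto)
qed

lemma computes_in_enc_bool_ball:
  assumes "computes_in (\<lambda>z. enc_bool (P (left z) (right z))) (\<lambda>z. U (left z) (right z))"
    and "computes_in L T"
    and le: "\<And>x. (\<Sum>a\<leftarrow>elems (L x). Suc (U x a)) \<le> C * Suc (T x)"
  shows "computes_in (\<lambda>x. enc_bool (\<forall>a \<in> set (elems (L x)). P x a)) T"
proof -
  \<comment> \<open>\<open>r\<close> has to be an encoded truth value: the empty fold returns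
    \<open>r\<close> itself, and a tree other than \<open>Leaf\<close> and
    \<open>enc_bool True\<close> would break the equation.\<close>
  have "foldl (\<lambda>r a. enc_bool (r \<noteq> Leaf \<and> P x a)) r as = enc_bool (r \<noteq> Leaf \<and> (\<forall>a \<in> set as. P x a))"
    if "r \<in> range enc_bool" for x r as
    using that by (induction as arbitrary: r) (auto simp: enc_bool_def)
  from this[OF rangeI[of enc_bool True]]
  have "foldl (\<lambda>r a. enc_bool (r \<noteq> Leaf \<and> P x a)) (enc_bool True) as = enc_bool (\<forall>a \<in> set as. P x a)"
    for x as
    by (simp add: enc_bool_def)
  moreover have "computes_in (\<lambda>x. foldl (\<lambda>r a. enc_bool (r \<noteq> Leaf \<and> P x a)) (enc_bool True) (elems (L x))) T"
    by (rule computes_in_foldl_sum[where h = U and C = C and \<tau> = "\<lambda>z. U (left z) (right (right z))"])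
      ((intro computes_in_intros assms computes_in_enc_bool_comp2[OF _ _ assms(1), where C = 1]; simp)+, simp, rule le)
  ultimately show ?thesis by simp
qed

lemma computes_in_enc_bool_bex:
  assumes "computes_in (\<lambda>z. enc_bool (P (left z) (right z))) (\<lambda>z. U (left z) (right z))"
    and "computes_in L T"
    and "\<And>x. (\<Sum>a\<leftarrow>elems (L x). Suc (U x a)) \<le> C * Suc (T x)"
  shows "computes_in (\<lambda>x. enc_bool (\<exists>a \<in> set (elems (L x)). P x a)) T"
  using computes_in_enc_bool_not[OF computes_in_enc_bool_ball[OF computes_in_enc_bool_not[OF assms(1)] assms(2,3)]]
  by simp

lemma length_elems_less_size: "length (elems d) < data_size d"
  by (induction d) auto

lemma data_size_pos: "0 < data_size d"
  by (cases d) auto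

lemma sum_list_size_elems: "(\<Sum>a\<leftarrow>elems d. data_size a) < data_size d"
  by (induction d) auto

section \<open>The algorithm\<close>

text \<open>Compares two bit lists in lockstep. The state \<open>Node f b\<close> means agreement so
  far, with \<open>b\<close> the unread rest of the second list; \<open>Leaf\<close> is failure and
  is absorbing because \<open>left Leaf = Leaf\<close>.\<close>

definition eq_step :: "data \<Rightarrow> data \<Rightarrow> data" where
  "eq_step r x = (if left r \<noteq> Leaf \<and> right r \<noteq> Leaf \<and> (x \<noteq> Leaf \<longleftrightarrow> left (right r) \<noteq> Leaf)
    then Node (enc_bool True) (right (right r)) else Leaf)"

text \<open>The loop runs over \<open>a\<close>, so the cost depends on \<open>a\<close> alone. All
  calls put the vertex being looked up or just read first, which keeps their cost independent of the
  accumulator.\<close>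

definition eq_nat :: "data \<Rightarrow> data \<Rightarrow> bool" where
  "eq_nat a b \<longleftrightarrow> left (foldl eq_step (Node (enc_bool True) b) (elems a)) \<noteq> Leaf \<and>
    right (foldl eq_step (Node (enc_bool True) b) (elems a)) = Leaf"

text \<open>
  A vertex without an entry is its own successor; as paths repeat no vertex, its route ends there.
\<close>

definition successor :: "data \<Rightarrow> data \<Rightarrow> data" where
  "successor c v = foldl (\<lambda>r p. if eq_nat v (left p) then right p else r) v (elems c)"

text \<open>In the state \<open>Node b e\<close>, \<open>e\<close> is the orbit vertex awaited next
  and \<open>b\<close> records whether the vertex read last was on the route. Since \<open>P\<close>
  ends in \<open>t\<close>, the final \<open>b\<close> tells whether the route ends in
  \<open>t\<close>.\<close>

definition scan_step :: "data \<Rightarrow> data \<Rightarrow> data \<Rightarrow> data" where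
  "scan_step c r v = (if eq_nat v (right r) then Node (enc_bool True) (successor c v)
    else Node Leaf (right r))"

definition routed :: "data \<Rightarrow> data \<Rightarrow> bool" where
  "routed c k \<longleftrightarrow> left (foldl (scan_step c) (Node Leaf (left k)) (elems (right (right k)))) \<noteq> Leaf"

text \<open>Repetitions are kept: the length is then exactly twice the number of commodities, which
  is all that the bounds need.\<close>

definition terminals :: "data \<Rightarrow> data" where
  "terminals ks = foldl (\<lambda>r k. Node (left k) (Node (left (right k)) r)) Leaf (elems ks)"

definition extend_by :: "data \<Rightarrow> data \<Rightarrow> data \<Rightarrow> data \<Rightarrow> data" where
  "extend_by ws u l c = foldl (\<lambda>l w. Node (Node (Node u w) c) l) l (elems ws)"

definition extend_all :: "data \<Rightarrow> data \<Rightarrow> data \<Rightarrow> data" where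
  "extend_all ws cs u = foldl (extend_by ws u) Leaf (elems cs)"

text \<open>The start is the list whose only entry is the empty assignment. A terminal repeated in
  \<open>ws\<close> gets several entries, possibly different ones; such a table still defines a
  map.\<close>

definition assignments :: "data \<Rightarrow> data" where
  "assignments ws = foldl (extend_all ws) (Node Leaf Leaf) (elems ws)"

text \<open>\<open>left (right x)\<close> is the encoded target: its left part is the sign, its
  right part the absolute value. For target 0 the list of terminals is replaced by the empty list,
  which leaves the empty assignment as the only candidate.\<close>

definition decide :: "data \<Rightarrow> bool" where
  "decide x \<longleftrightarrow> left (left (right x)) = Leaf \<and>
    (\<exists>c \<in> set (elems (assignments (if right (left (right x)) \<noteq> Leaf then terminals (right (right x)) else Leaf))).
      \<forall>k \<in> set (elems (right (right x))). routed c k)"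

section \<open>Running time of comparison, lookup and routing\<close>

lemma computes_in_eq_nat:
  "computes_in (\<lambda>z. enc_bool (eq_nat (left z) (right z))) (\<lambda>z. data_size (left z))"
proof -
  have "computes_in (\<lambda>z. foldl eq_step (Node (enc_bool True) (right z)) (elems (left z)))
    (\<lambda>z. data_size (left z))"
    by (rule computes_in_foldl_sum[where \<tau> = "\<lambda>_. 0" and h = "\<lambda>_ _. 0" and C = 1])
      (auto simp: sum_list_triv eq_step_def[abs_def] intro!: computes_in_intros
        order.strict_implies_order[OF length_elems_less_size] le_SucI)
  then show ?thesis unfolding eq_nat_def by (intro computes_in_intros)
qed

lemma computes_in_successor:
  "computes_in (\<lambda>z. successor (left z) (right z)) (\<lambda>z. Suc (length (elems (left z))) * data_size (right z))"
  unfolding successor_def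
proof (rule computes_in_foldl_sum[where \<tau> = "\<lambda>z. data_size (right (left z))" and h = "\<lambda>x _. data_size (right x)" and C = 2])
  fix x
  obtain n where "data_size (right x) = Suc n" using data_size_pos gr0_implies_Suc by blast
  then show "(\<Sum>a\<leftarrow>elems (left x). Suc (data_size (right x)))
    \<le> 2 * Suc (Suc (length (elems (left x))) * data_size (right x))"
    by (simp add: sum_list_triv)
qed ((intro computes_in_intros computes_in_enc_bool_comp2[OF _ _ computes_in_eq_nat, where C = 1]; simp)+, simp)

lemma computes_in_routed:
  "computes_in (\<lambda>z. enc_bool (routed (left z) (right z)))
    (\<lambda>z. Suc (length (elems (left z))) * data_size (right z))"
  unfolding routed_def
proof (rule computes_in_enc_bool_neq_Leaf, rule computes_in_left,
    rule computes_in_foldl_sum[where \<tau> = "\<lambda>z. Suc (length (elems (left (left z)))) * data_size (right (right z))"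
      and h = "\<lambda>x a. Suc (length (elems (left x))) * data_size a" and C = 2])
  show "computes_in (\<lambda>z. scan_step (left (left z)) (left (right z)) (right (right z)))
     (\<lambda>z. Suc (length (elems (left (left z)))) * data_size (right (right z)))"
    unfolding scan_step_def
    by (intro computes_in_intros computes_in_enc_bool_comp2[OF _ _ computes_in_eq_nat, where C = 1]
      computes_in_comp2[OF _ _ computes_in_successor, where C = 1]; simp)
  show "(\<Sum>a\<leftarrow>elems (right (right (right x))). Suc (Suc (length (elems (left x))) * data_size a))
    \<le> 2 * Suc (Suc (length (elems (left x))) * data_size (right x))" for x
  proof -
    let ?P = "right (right (right x))" and ?n = "Suc (length (elems (left x)))"
    have size: "data_size ?P \<le> data_size (right x)"
      by (cases "right x"; cases "right (right x)") auto
    have "(\<Sum>a\<leftarrow>elems ?P. Suc (?n * data_size a)) = length (elems ?P) + ?n * (\<Sum>a\<leftarrow>elems ?P. data_size a)"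
      by (simp add: sum_list_Suc sum_list_const_mult del: mult_Suc)
    also have "\<dots> \<le> ?n * data_size ?P + ?n * data_size ?P"
    proof (rule add_mono)
      show "length (elems ?P) \<le> ?n * data_size ?P"
        using length_elems_less_size[of ?P] by simp
    qed (use sum_list_size_elems[of ?P] in \<open>simp del: mult_Suc\<close>)
    also have "\<dots> \<le> ?n * data_size (right x) + ?n * data_size (right x)"
      using size by (intro add_mono mult_le_mono2)
    finally show ?thesis by simp
  qed
qed ((intro computes_in_intros; simp)+, simp)

section \<open>Number of candidate assignments and cost of listing them\<close>

lemma elems_extend_by:
  "elems (extend_by ws u l c) = rev (map (\<lambda>w. Node (Node u w) c) (elems ws)) @ elems l"
proof -
  have "elems (foldl (\<lambda>l w. Node (Node (Node u w) c) l) l xs) = rev (map (\<lambda>w. Node (Node u w) c) xs) @ elems l" for xs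
    by (induction xs arbitrary: l) auto
  then show ?thesis by (simp add: extend_by_def)
qed

lemma length_elems_extend_all: "length (elems (extend_all ws cs u)) = length (elems cs) * length (elems ws)"
proof -
  have "length (elems (foldl (extend_by ws u) l xs)) = length (elems l) + length xs * length (elems ws)" for l xs
    by (induction xs arbitrary: l) (auto simp: elems_extend_by)
  then show ?thesis by (simp add: extend_all_def)
qed

lemma set_elems_extend_all:
  "set (elems (extend_all ws cs u)) = (\<lambda>(c, w). Node (Node u w) c) ` (set (elems cs) \<times> set (elems ws))"
proof -
  have "set (elems (foldl (extend_by ws u) l xs)) =
      set (elems l) \<union> (\<lambda>(c, w). Node (Node u w) c) ` (set xs \<times> set (elems ws))" for l xs
    by (induction xs arbitrary: l) (auto simp: elems_extend_by)
  then show ?thesis by (simp add: extend_all_def)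
qed

lemma length_elems_assignments:
  "length (elems (assignments ws)) = length (elems ws) ^ length (elems ws)"
proof -
  have "length (elems (foldl (extend_all ws) cs us)) = length (elems cs) * length (elems ws) ^ length us" for cs us
    by (induction us arbitrary: cs) (auto simp: length_elems_extend_all)
  then show ?thesis by (simp add: assignments_def)
qed

lemma length_elems_assignment:
  assumes "c \<in> set (elems (assignments ws))"
  shows "length (elems c) = length (elems ws)"
proof -
  have "\<forall>c \<in> set (elems (foldl (extend_all ws) cs us)). length (elems c) = n + length us"
    if "\<forall>c \<in> set (elems cs). length (elems c) = n" for cs us n
    using that
  proof (induction us arbitrary: cs n)
    case (Cons u us)
    then have "\<forall>c \<in> set (elems (extend_all ws cs u)). length (elems c) = Suc n"
      by (auto simp: set_elems_extend_all)
    from Cons.IH[OF this] show ?case by simp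
  qed simp
  from this[of "Node Leaf Leaf" 0] assms show ?thesis by (simp add: assignments_def)
qed

lemma length_elems_terminals: "length (elems (terminals ks)) = 2 * length (elems ks)"
proof -
  have "length (elems (foldl (\<lambda>r k. Node (left k) (Node (left (right k)) r)) r xs)) =
      length (elems r) + 2 * length xs" for r xs
    by (induction xs arbitrary: r) auto
  then show ?thesis by (simp add: terminals_def)
qed

text \<open>The argument is the tree that \<open>computes_in_foldl\<close> hands to a step of
  \<open>extend_all\<close>: context \<open>Node ws (Node cs u)\<close>, accumulator
  \<open>l\<close>, element \<open>c\<close>. Each extension takes constant time whatever the size
  of \<open>c\<close>.\<close>

lemma computes_in_extend_by:
  "computes_in (\<lambda>z. extend_by (left (left z)) (right (right (left z))) (left (right z)) (right (right z)))
    (\<lambda>z. length (elems (left (left z))))"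
  unfolding extend_by_def
  by (rule computes_in_foldl_sum[where \<tau> = "\<lambda>_. 0" and h = "\<lambda>_ _. 0" and C = 1])
    ((intro computes_in_intros; simp)+, simp_all add: sum_list_triv)

lemma computes_in_extend_all:
  "computes_in (\<lambda>z. extend_all (left z) (left (right z)) (right (right z)))
    (\<lambda>z. Suc (length (elems (left z))) * length (elems (left (right z))))"
  unfolding extend_all_def
proof (rule computes_in_foldl_sum[OF computes_in_extend_by, where h = "\<lambda>z _. length (elems (left z))" and C = 1])
qed ((intro computes_in_intros; simp)+, simp_all add: sum_list_triv)

text \<open>\<open>N\<close> bounds the length of the accumulator in every round: each round
  multiplies it by the positive \<open>length (elems ws)\<close>, so the final length is the
  largest.\<close>

lemma fold_time_extend_all_le:
  assumes "0 < length (elems ws)" and "length (elems r) * length (elems ws) ^ length us \<le> N"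
  shows "fold_time (\<lambda>r _. Suc (length (elems ws)) * length (elems r)) (extend_all ws) r us
    \<le> length us * Suc (Suc (length (elems ws)) * N)"
  using assms(2)
proof (induction us arbitrary: r)
  case (Cons u us)
  let ?n = "length (elems ws)"
  have "length (elems r) * 1 \<le> length (elems r) * ?n ^ length (u # us)"
    using assms(1) by (intro mult_le_mono2) (simp add: Suc_le_eq)
  then have "length (elems r) \<le> N" using Cons.prems by linarith
  then have "Suc ?n * length (elems r) \<le> Suc ?n * N" by (rule mult_le_mono2)
  moreover have "fold_time (\<lambda>r _. Suc ?n * length (elems r)) (extend_all ws) (extend_all ws r u) us
      \<le> length us * Suc (Suc ?n * N)"
    by (rule Cons.IH) (use Cons.prems in \<open>simp add: length_elems_extend_all mult.assoc\<close>)
  ultimately show ?case by simp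
qed simp

lemma computes_in_assignments:
  "computes_in assignments (\<lambda>ws. length (elems ws) *
    Suc (Suc (length (elems ws)) * length (elems ws) ^ length (elems ws)))"
  unfolding assignments_def[abs_def]
proof (rule computes_in_foldl[OF computes_in_extend_all, where C = 1])
  fix ws
  let ?n = "length (elems ws)"
  have "fold_time (\<lambda>r _. Suc ?n * length (elems r)) (extend_all ws) (Node Leaf Leaf) (elems ws)
      \<le> ?n * Suc (Suc ?n * ?n ^ ?n)"
    by (cases "elems ws = []", simp) (intro fold_time_extend_all_le; simp)
  then show "fold_time (\<lambda>r a. Suc (length (elems (left (Node ws (Node r a))))) *
        length (elems (left (right (Node ws (Node r a)))))) (extend_all ws) (Node Leaf Leaf) (elems ws)
      \<le> 1 * Suc (?n * Suc (Suc ?n * ?n ^ ?n))"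
    by simp
qed (intro computes_in_intros)+

lemma computes_in_terminals: "computes_in terminals (\<lambda>ks. length (elems ks))"
  unfolding terminals_def[abs_def]
  by (rule computes_in_foldl_sum[where \<tau> = "\<lambda>_. 0" and h = "\<lambda>_ _. 0" and C = 1])
    ((intro computes_in_intros; simp)+, simp_all add: sum_list_triv)

section \<open>Cost of the whole search\<close>

lemma computes_in_all_routed:
  "computes_in (\<lambda>z. enc_bool (\<forall>k \<in> set (elems (left z)). routed (right z) k))
    (\<lambda>z. Suc (length (elems (right z))) * data_size (left z))"
proof (rule computes_in_enc_bool_ball[where U = "\<lambda>z k. Suc (length (elems (right z))) * data_size k" and C = 2])
  fix z
  let ?n = "Suc (length (elems (right z)))" and ?ks = "left z"
  have "(\<Sum>k\<leftarrow>elems ?ks. Suc (?n * data_size k)) = length (elems ?ks) + ?n * (\<Sum>k\<leftarrow>elems ?ks. data_size k)"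
    by (simp add: sum_list_Suc sum_list_const_mult del: mult_Suc)
  also have "\<dots> \<le> ?n * data_size ?ks + ?n * data_size ?ks"
  proof (rule add_mono)
    show "length (elems ?ks) \<le> ?n * data_size ?ks" using length_elems_less_size[of ?ks] by simp
  qed (use sum_list_size_elems[of ?ks] in \<open>simp del: mult_Suc\<close>)
  finally show "(\<Sum>k\<leftarrow>elems ?ks. Suc (?n * data_size k)) \<le> 2 * Suc (?n * data_size ?ks)" by simp
qed (intro computes_in_intros computes_in_enc_bool_comp2[OF _ _ computes_in_routed, where C = 1]; simp)+

text \<open>The bound stays a sum over the candidates; that they all have the same length is only
  known for the output of \<open>assignments\<close>.\<close>

lemma computes_in_some_routed:
  "computes_in (\<lambda>z. enc_bool (\<exists>c \<in> set (elems (right z)). \<forall>k \<in> set (elems (left z)). routed c k))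
    (\<lambda>z. \<Sum>c\<leftarrow>elems (right z). Suc (Suc (length (elems c)) * data_size (left z)))"
proof (rule computes_in_enc_bool_bex[where U = "\<lambda>z c. Suc (length (elems c)) * data_size (left z)" and C = 1])
  show "computes_in (\<lambda>z. enc_bool (\<forall>k \<in> set (elems (left (left z))). routed (right z) k))
     (\<lambda>z. Suc (length (elems (right z))) * data_size (left (left z)))"
    by (rule computes_in_enc_bool_comp2[OF _ _ computes_in_all_routed, where C = 1])
      ((intro computes_in_intros)?; simp)+
qed ((intro computes_in_intros)?; simp)+

definition search_bound :: "data \<Rightarrow> nat" where
  "search_bound x = (2 * length (elems (right (right x)))) ^ (2 * length (elems (right (right x))))"

text \<open>In the routing test one factor \<open>data_size x\<close> covers the length of an
  assignment, the other the size of the commodity list. Listing the assignments costs no more: one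
  factor for the rounds, one for the extensions within a round.\<close>

lemma computes_in_decide:
  "computes_in (\<lambda>x. enc_bool (decide x)) (\<lambda>x. search_bound x * data_size x ^ 2)"
proof -
  define T where "T x = search_bound x * data_size x ^ 2" for x
  define ks where "ks x = right (right x)" for x
  define ws where "ws x = (if right (left (right x)) \<noteq> Leaf then terminals (ks x) else Leaf)" for x
  have size_ks: "data_size (ks x) \<le> data_size x" for x
    unfolding ks_def by (cases x; cases "right x") auto
  \<comment> \<open>Even without commodities, as \<open>0 ^ 0 = 1\<close>. Positivity also covers
    target 0, where \<open>ws x\<close> is empty and one candidate remains.\<close>
  have pos: "0 < search_bound x" for x unfolding search_bound_def by (cases "elems (right (right x))") auto
  have ws: "length (elems (ws x)) \<le> 2 * data_size x"
      "length (elems (ws x)) ^ length (elems (ws x)) \<le> search_bound x" for x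
  proof -
    have "length (elems (ks x)) \<le> data_size x"
      using size_ks[of x] length_elems_less_size[of "ks x"] by simp
    then show "length (elems (ws x)) \<le> 2 * data_size x"
      by (simp add: ws_def length_elems_terminals)
    show "length (elems (ws x)) ^ length (elems (ws x)) \<le> search_bound x"
      using pos[of x] by (cases "right (left (right x)) = Leaf")
        (simp_all add: ws_def length_elems_terminals Suc_le_eq, simp add: search_bound_def ks_def)
  qed
  have sq: "data_size x \<le> data_size x ^ 2" for x by (simp add: power2_eq_square)
  have le_T: "data_size x ^ 2 \<le> T x" for x using pos[of x] unfolding T_def by simp
  have "computes_in ks T" unfolding ks_def by (intro computes_in_intros)
  moreover have "computes_in ws T"
    unfolding ws_def
  proof (intro computes_in_intros computes_in_comp[OF \<open>computes_in ks T\<close> computes_in_terminals])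
    show "length (elems (ks x)) \<le> 1 * Suc (T x)" for x
      using size_ks[of x] length_elems_less_size[of "ks x"] sq[of x] le_T[of x] by simp
  qed
  then have "computes_in (\<lambda>x. assignments (ws x)) T"
  proof (rule computes_in_comp[OF _ computes_in_assignments])
    fix x
    let ?n = "length (elems (ws x))" and ?s = "data_size x"
    have "?n * Suc (Suc ?n * ?n ^ ?n) \<le> (2 * ?s) * (4 * (?s * search_bound x))"
    proof (rule mult_le_mono[OF ws(1)])
      \<comment> \<open>From \<open>?n \<le> 2 * ?s\<close> and \<open>1 \<le> ?s\<close> comes
        \<open>Suc ?n \<le> 3 * ?s\<close>; the outer \<open>Suc\<close> raises 3 to 4.\<close>
      have "Suc ?n * ?n ^ ?n \<le> (3 * ?s) * search_bound x"
        using ws[of x] data_size_pos[of x] by (intro mult_le_mono) auto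
      moreover have "1 \<le> ?s * search_bound x" using pos[of x] data_size_pos[of x] by (simp add: Suc_le_eq)
      ultimately show "Suc (Suc ?n * ?n ^ ?n) \<le> 4 * (?s * search_bound x)"
        unfolding mult.assoc by linarith
    qed
    then show "?n * Suc (Suc ?n * ?n ^ ?n) \<le> 8 * Suc (T x)"
      by (simp add: T_def power2_eq_square algebra_simps)
  qed
  ultimately have "computes_in (\<lambda>x. enc_bool (\<exists>c \<in> set (elems (assignments (ws x))).
      \<forall>k \<in> set (elems (ks x)). routed c k)) T"
  proof (rule computes_in_enc_bool_comp2[OF _ _ computes_in_some_routed])
    fix x
    let ?n = "length (elems (ws x))" and ?s = "data_size x"
    have "map (\<lambda>c. Suc (Suc (length (elems c)) * data_size (ks x))) (elems (assignments (ws x))) =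
        map (\<lambda>c. Suc (Suc ?n * data_size (ks x))) (elems (assignments (ws x)))"
      by (simp add: length_elems_assignment)
    then have "(\<Sum>c\<leftarrow>elems (assignments (ws x)). Suc (Suc (length (elems c)) * data_size (ks x))) =
        ?n ^ ?n * Suc (Suc ?n * data_size (ks x))"
      by (simp only: sum_list_triv length_elems_assignments of_nat_id)
    also have "\<dots> \<le> search_bound x * (4 * ?s ^ 2)"
    proof (rule mult_le_mono[OF ws(2)])
      have "Suc ?n * data_size (ks x) \<le> (3 * ?s) * ?s"
        using ws(1)[of x] size_ks[of x] data_size_pos[of x] by (intro mult_le_mono) auto
      moreover have "1 \<le> ?s * ?s" using data_size_pos[of x] by (simp add: Suc_le_eq)
      ultimately show "Suc (Suc ?n * data_size (ks x)) \<le> 4 * ?s ^ 2"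
        unfolding power2_eq_square mult.assoc by linarith
    qed
    finally show "(\<Sum>c\<leftarrow>elems (assignments (ws x)). Suc (Suc (length (elems c)) * data_size (ks x)))
        \<le> 4 * Suc (T x)" by (simp add: T_def)
  qed
  then have "computes_in (\<lambda>x. enc_bool (decide x)) T"
    unfolding decide_def ks_def ws_def by (intro computes_in_intros)
  then show ?thesis unfolding T_def .
qed

text \<open>The search computes its own bound: \<open>unary n\<close> is a list of length
  \<open>n\<close>, so the assignments on its terminals number \<open>(2 * n) ^ (2 * n)\<close>, and
  a fold counts them in unary. Computability asks only for termination, so any \<open>T\<close> will
  do.\<close>

lemma computable_search_bound: "computable (\<lambda>n. (2 * n) ^ (2 * n))"
proof -
  define F where "F x = foldl (\<lambda>r _. Node Leaf r) Leaf (elems (assignments (terminals x)))" for x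
  have foldl_unary: "foldl (\<lambda>r _. Node Leaf r) (unary m) as = unary (m + length as)" for m and as :: "data list"
  proof (induction as arbitrary: m)
    case (Cons a as)
    have "foldl (\<lambda>r _. Node Leaf r) (unary (Suc m)) as = unary (Suc m + length as)" by (rule Cons.IH)
    then show ?case by simp
  qed simp
  have "length (elems (unary n)) = n" for n by (induction n) auto
  then have F: "F (unary n) = unary ((2 * n) ^ (2 * n))" for n
    using foldl_unary[of 0] by (simp add: F_def length_elems_assignments length_elems_terminals)
  obtain T where "computes_in F T"
  proof
    define n where "n x = 2 * length (elems x)" for x
    define T where "T x = n x * Suc (Suc (n x) * n x ^ n x) + length (elems x) + n x ^ n x" for x
    have "computes_in terminals T"
      by (rule computes_in_weaken[OF computes_in_terminals, where C = 1]) (simp add: T_def)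
    then have "computes_in (\<lambda>x. assignments (terminals x)) T"
      by (rule computes_in_comp[OF _ computes_in_assignments, where C = 1])
        (simp add: T_def n_def length_elems_terminals)
    then show "computes_in F T"
      unfolding F_def[abs_def]
      by (rule computes_in_foldl_sum[where \<tau> = "\<lambda>_. 0" and h = "\<lambda>_ _. 0" and C = 1, rotated 2])
        (auto simp: T_def n_def length_elems_terminals length_elems_assignments sum_list_triv
          intro!: computes_in_intros)
  qed
  then obtain p C where "realizes p F (\<lambda>x. C * Suc (T x))" unfolding computes_in_def by blast
  then have "\<exists>t. runs p (unary n) t (F (unary n))" for n
    unfolding realizes_def runs_def by (metis fun_upd_same)
  then show ?thesis unfolding computable_def F by blast
qed

section \<open>Routing along orbits\<close>

lemma vwalk_arcs_append_Cons:
  "(u, v) \<in> set (vwalk_arcs P) \<longleftrightarrow> (\<exists>A B. P = A @ u # v # B)"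
proof (induction P rule: vwalk_arcs.induct)
  case (3 x y xs)
  show ?case
  proof
    assume "(u, v) \<in> set (vwalk_arcs (x # y # xs))"
    then consider "u = x" "v = y" | "(u, v) \<in> set (vwalk_arcs (y # xs))" by auto
    then show "\<exists>A B. x # y # xs = A @ u # v # B"
    proof cases
      case 1
      then show ?thesis by (intro exI[of _ "[]"] exI[of _ xs]) simp
    next
      case 2
      then obtain A B where "y # xs = A @ u # v # B" using 3 by blast
      then show ?thesis by (intro exI[of _ "x # A"] exI[of _ B]) simp
    qed
  next
    assume "\<exists>A B. x # y # xs = A @ u # v # B"
    then obtain A B where AB: "x # y # xs = A @ u # v # B" by blast
    show "(u, v) \<in> set (vwalk_arcs (x # y # xs))"
    proof (cases A)
      case Nil
      then show ?thesis using AB by simp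
    next
      case (Cons a A')
      then have "y # xs = A' @ u # v # B" using AB by simp
      then show ?thesis using 3 by auto
    qed
  qed
qed auto

text \<open>Distinctness gives \<open>y\<close> a single position in \<open>P\<close>, so in the
  induction the two decompositions around \<open>y\<close> agree, and the vertex right after
  \<open>y\<close> also comes after \<open>u\<close>.\<close>

lemma trancl_vwalk_arcs_iff:
  assumes "distinct P"
  shows "(u, v) \<in> (set (vwalk_arcs P))\<^sup>+ \<longleftrightarrow> (\<exists>A B C. P = A @ u # B @ v # C)"
proof
  assume "(u, v) \<in> (set (vwalk_arcs P))\<^sup>+"
  then show "\<exists>A B C. P = A @ u # B @ v # C"
  proof (induction rule: trancl_induct)
    case (base y)
    then show ?case using vwalk_arcs_append_Cons by (metis append_Nil)
  next
    case (step y z)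
    obtain A B C where 1: "P = A @ u # B @ y # C" using step.IH by blast
    obtain D E where 2: "P = D @ y # z # E" using step.hyps(2) vwalk_arcs_append_Cons[of y z P] by blast
    have "(A @ u # B) @ y # C = D @ y # z # E" using 1 2 by simp
    moreover have "y \<notin> set (A @ u # B)" using assms unfolding 1 by auto
    moreover have "y \<notin> set C" using assms unfolding 1 by auto
    ultimately have "C = z # E" using append_Cons_eq_iff[of y "A @ u # B" C D "z # E"] by blast
    with 1 have "P = A @ u # (B @ [y]) @ z # E" by simp
    then show ?case by blast
  qed
next
  assume "\<exists>A B C. P = A @ u # B @ v # C"
  then obtain A B C where "P = A @ u # B @ v # C" by blast
  then show "(u, v) \<in> (set (vwalk_arcs P))\<^sup>+"
  proof (induction B arbitrary: A u)
    case Nil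
    then show ?case using vwalk_arcs_append_Cons by fastforce
  next
    case (Cons b B)
    then have "P = (A @ [u]) @ b # B @ v # C" by simp
    then have "(b, v) \<in> (set (vwalk_arcs P))\<^sup>+" by (rule Cons.IH)
    moreover have "(u, b) \<in> set (vwalk_arcs P)" using Cons.prems vwalk_arcs_append_Cons by fastforce
    ultimately show ?case by simp
  qed
qed

lemma subseq_Cons_neq:
  "x \<noteq> y \<Longrightarrow> subseq (x # xs) (y # ys) \<longleftrightarrow> subseq (x # xs) ys"
  by (auto elim: list_emb.cases)

lemma subseq_drop_prefix:
  "subseq (y # ys) (D @ zs) \<Longrightarrow> y \<notin> set D \<Longrightarrow> subseq (y # ys) zs"
  by (induction D) (simp_all add: subseq_Cons_neq)

text \<open>Forward arcs chain to a subsequence because each vertex has only one position in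
  \<open>P\<close>. The assumption on \<open>set q\<close> settles a single vertex, which has no
  arcs.\<close>

lemma vwalk_arcs_subset_iff_subseq:
  assumes "distinct P" and "set q \<subseteq> set P"
  shows "set (vwalk_arcs q) \<subseteq> (set (vwalk_arcs P))\<^sup>+ \<longleftrightarrow> subseq q P"
  using assms(2)
proof (induction q rule: vwalk_arcs.induct)
  case (2 x)
  then show ?case by (simp add: subseq_singleton_left)
next
  case (3 x y xs)
  have IH: "set (vwalk_arcs (y # xs)) \<subseteq> (set (vwalk_arcs P))\<^sup>+ \<longleftrightarrow> subseq (y # xs) P"
    using 3 by simp
  show ?case
  proof
    assume a: "set (vwalk_arcs (x # y # xs)) \<subseteq> (set (vwalk_arcs P))\<^sup>+"
    then have "(x, y) \<in> (set (vwalk_arcs P))\<^sup>+" by simp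
    then obtain A B C where P: "P = A @ x # B @ y # C" using trancl_vwalk_arcs_iff[OF assms(1)] by blast
    have "subseq (y # xs) ((A @ x # B) @ y # C)" using a IH P by simp
    \<comment> \<open>\<open>y\<close> occurs only after \<open>x\<close>, so an embedding of the
      rest of the list into \<open>P\<close> avoids everything up to \<open>x\<close>.\<close>
    moreover have "y \<notin> set (A @ x # B)" using assms(1) P by auto
    ultimately have "subseq (y # xs) (y # C)"
      by (rule subseq_drop_prefix)
    then show "subseq (x # y # xs) P" using P by (simp add: list_emb_append2)
  next
    assume s: "subseq (x # y # xs) P"
    then obtain A R where R: "P = A @ x # R" "subseq (y # xs) R" using list_emb_ConsD[OF s] by blast
    then obtain B C where "R = B @ y # C" using list_emb_ConsD[OF R(2)] by blast
    with R(1) have "(x, y) \<in> (set (vwalk_arcs P))\<^sup>+" using trancl_vwalk_arcs_iff[OF assms(1)] by blast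
    moreover have "subseq (y # xs) P" using s by (metis subseq_Cons')
    ultimately show "set (vwalk_arcs (x # y # xs)) \<subseteq> (set (vwalk_arcs P))\<^sup>+" using IH by simp
  qed
qed simp

section \<open>The greedy scan of a path\<close>

primrec orbit_scan :: "('a \<Rightarrow> 'a) \<Rightarrow> bool \<times> 'a \<Rightarrow> 'a list \<Rightarrow> bool" where
  "orbit_scan g r [] = fst r"
| "orbit_scan g r (v # P) = orbit_scan g (if v = snd r then (True, g v) else (False, snd r)) P"

text \<open>The greedy choice is forced: \<open>e\<close> occurs at most once in \<open>P\<close>,
  so it can be matched at only one place, and \<open>g\<close> dictates what follows. The flag
  \<open>b\<close> is arbitrary since the first vertex read overwrites it.\<close>

lemma orbit_scan_iff:
  assumes "distinct P" and "P \<noteq> []"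
  shows "orbit_scan g (b, e) P \<longleftrightarrow>
    (\<exists>q. subseq (e # q) P \<and> last (e # q) = last P \<and> successively (\<lambda>u v. v = g u) (e # q))"
  using assms
proof (induction P arbitrary: b e)
  case (Cons v P)
  show ?case
  proof (cases "P = []")
    case True
    then show ?thesis by (cases "v = e") (auto simp: subseq_singleton_left intro: exI[of _ "[]"] dest: list_emb_length)
  next
    case P: False
    show ?thesis
    proof (cases "v = e")
      case True
      have "orbit_scan g (b, e) (v # P) \<longleftrightarrow> (\<exists>q. subseq (g e # q) P \<and> last (g e # q) = last P
          \<and> successively (\<lambda>u v. v = g u) (g e # q))"
        using True Cons.IH[of True "g e"] Cons.prems(1) P by (simp del: last.simps successively.simps)
      also have "\<dots> \<longleftrightarrow> (\<exists>q. subseq (e # q) (v # P) \<and> last (e # q) = last (v # P) \<and>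
          successively (\<lambda>u v. v = g u) (e # q))" (is "?L \<longleftrightarrow> ?R")
      proof
        assume ?L
        then obtain q where "subseq (g e # q) P" "last (g e # q) = last P"
          "successively (\<lambda>u v. v = g u) (g e # q)" by blast
        then have "subseq (e # g e # q) (v # P)" "last (e # g e # q) = last (v # P)"
          "successively (\<lambda>u v. v = g u) (e # g e # q)" using True P by simp_all
        then show ?R by blast
      next
        assume ?R
        then obtain q where q: "subseq (e # q) (v # P)" "last (e # q) = last (v # P)"
          "successively (\<lambda>u v. v = g u) (e # q)" by blast
        \<comment> \<open>\<open>e\<close> was just read and does not recur, so a route to the last
          vertex cannot stop here and must continue with \<open>g e\<close>.\<close>
        have "e \<noteq> last P" using True Cons.prems P by auto
        then obtain w q' where q': "q = w # q'" using q(2) P by (cases q) auto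
        have "w = g e" using q(3) q' by simp
        have "subseq (g e # q') P" "last (g e # q') = last P"
          "successively (\<lambda>u v. v = g u) (g e # q')"
          using q True P unfolding q' \<open>w = g e\<close> by simp_all
        then show ?L by blast
      qed
      finally show ?thesis .
    next
      case False
      then have "orbit_scan g (b, e) (v # P) \<longleftrightarrow> (\<exists>q. subseq (e # q) P \<and> last (e # q) = last P
          \<and> successively (\<lambda>u v. v = g u) (e # q))"
        using Cons.IH[of False e] Cons.prems(1) P by (simp del: last.simps successively.simps)
      then show ?thesis using False P by (simp add: subseq_Cons_neq del: successively.simps)
    qed
  qed
qed simp

section \<open>First return maps\<close>

inductive first_return :: "('a \<Rightarrow> 'a) \<Rightarrow> 'a set \<Rightarrow> 'a \<Rightarrow> 'a \<Rightarrow> bool" for h X where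
  "h u \<in> X \<Longrightarrow> first_return h X u (h u)"
| "h u \<notin> X \<Longrightarrow> first_return h X (h u) v \<Longrightarrow> first_return h X u v"

lemma first_return_unique: "first_return h X u v \<Longrightarrow> first_return h X u w \<Longrightarrow> v = w"
proof (induction arbitrary: w rule: first_return.induct)
  case (1 u)
  from 1(2,1) show ?case by (cases rule: first_return.cases) auto
next
  case (2 u v)
  from 2(4,1,3) show ?case by (cases rule: first_return.cases) auto
qed

lemma first_return_mem: "first_return h X u v \<Longrightarrow> v \<in> X"
  by (induction rule: first_return.induct)

text \<open>The first return map of dynamics, made total. Outside \<open>X\<close>, and where the
  orbit never comes back to \<open>X\<close>, the default is the identity, as for a vertex without
  entry in \<open>successor\<close>.\<close>

definition return_map :: "('a \<Rightarrow> 'a) \<Rightarrow> 'a set \<Rightarrow> 'a \<Rightarrow> 'a" where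
  "return_map h X u = (if u \<in> X \<and> (\<exists>v. first_return h X u v) then THE v. first_return h X u v else u)"

lemma return_map_eq: "first_return h X u v \<Longrightarrow> u \<in> X \<Longrightarrow> return_map h X u = v"
  unfolding return_map_def using first_return_unique by (metis (mono_tags, lifting) the_equality)

lemma return_map_mem: "u \<in> X \<Longrightarrow> return_map h X u \<in> X"
  by (metis return_map_def return_map_eq first_return_mem)

lemma first_return_hd_filter:
  assumes "successively (\<lambda>u v. v = h u) (a # q)" and "filter (\<lambda>v. v \<in> X) q = b # r"
  shows "first_return h X a b"
  using assms
proof (induction q arbitrary: a)
  case (Cons c q)
  then show ?case by (cases "c \<in> X") (auto intro: first_return.intros)
qed simp

text \<open>Between two consecutive survivors of the filter the orbit runs outside \<open>X\<close>,
  so the second is the first return of the first. This is the bypassing of vertices that are not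
  ends.\<close>

lemma successively_return_map_filter:
  assumes "successively (\<lambda>u v. v = h u) q"
  shows "successively (\<lambda>u v. v = return_map h X u) (filter (\<lambda>v. v \<in> X) q)"
  using assms
proof (induction q)
  case (Cons a q)
  then have IH: "successively (\<lambda>u v. v = return_map h X u) (filter (\<lambda>v. v \<in> X) q)"
    by (auto simp: successively_Cons)
  show ?case
  proof (cases "a \<in> X \<and> filter (\<lambda>v. v \<in> X) q \<noteq> []")
    case True
    then obtain b r where b: "filter (\<lambda>v. v \<in> X) q = b # r" by (meson neq_Nil_conv)
    then have "return_map h X a = b"
      using first_return_hd_filter[OF Cons.prems] return_map_eq True by metis
    then show ?thesis using IH b by auto
  qed (use IH in auto)
qed simp

section \<open>Solutions and maps that route all commodities\<close>

lemma successively_vwalk_arcs: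
  "successively R q \<longleftrightarrow> (\<forall>(u, v) \<in> set (vwalk_arcs q). R u v)"
  by (induction q rule: vwalk_arcs.induct) auto

lemma dipath_iff:
  "dipath G s P t \<longleftrightarrow> P \<noteq> [] \<and> distinct P \<and> set P \<subseteq> pverts G \<and> set (vwalk_arcs P) \<subseteq> parcs G \<and>
    hd P = s \<and> last P = t"
  by (auto simp: dipath_def vpath_def vwalk_def arcs_ends_def arc_to_ends_def)

lemma set_subseq: "subseq xs ys \<Longrightarrow> set xs \<subseteq> set ys"
  by (auto simp: subseq_conv_nths dest: in_set_nthsD)

lemma distinct_subseq: "subseq xs ys \<Longrightarrow> distinct ys \<Longrightarrow> distinct xs"
  by (auto simp: subseq_conv_nths intro: distinct_nthsI)

lemma dipath_inter_path_iff:
  assumes "distinct P"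
  shows "dipath (digraph_inter H (transitive_closure (path_digraph P))) s q t \<longleftrightarrow>
    q \<noteq> [] \<and> subseq q P \<and> set q \<subseteq> pverts H \<and> set (vwalk_arcs q) \<subseteq> parcs H \<and> hd q = s \<and> last q = t"
proof -
  have "distinct q" "set q \<subseteq> set P" if "subseq q P"
    using that assms distinct_subseq set_subseq by blast+
  then show ?thesis
    using vwalk_arcs_subset_iff_subseq[OF assms, of q]
    by (auto simp: dipath_iff digraph_inter_def transitive_closure_def path_digraph_def)
qed

lemma md_spp_solvableI:
  assumes valid: "md_spp_valid I" and "0 \<le> target I" and g: "target I = 0 \<Longrightarrow> g = id"
    and scan: "\<And>s t P. (s, t, P) \<in> commodities I \<Longrightarrow> orbit_scan g (False, s) P"
  shows "md_spp_solvable I"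
proof -
  let ?D = "base_digraph I"
  interpret pair_fin_digraph ?D using valid unfolding md_spp_valid_def by blast
  \<comment> \<open>Loops are left out so that \<open>g = id\<close> gives outdegree 0. The
    intersection with the closure makes \<open>H\<close> a subgraph whatever the values of
    \<open>g\<close>.\<close>
  define H where "H = \<lparr>pverts = pverts ?D, parcs = {(u, v). v = g u \<and> u \<noteq> v \<and> (u, v) \<in> (parcs ?D)\<^sup>+}\<rparr>"
  have closed: "(u, v) \<in> (parcs ?D)\<^sup>+ \<Longrightarrow> u \<in> pverts ?D \<and> v \<in> pverts ?D" for u v
    by (induction rule: trancl_induct) (auto dest: in_arcsD1 in_arcsD2)
  have "subgraph (with_proj H) (with_proj (transitive_closure ?D))"
    unfolding subgraph_def
    by (auto simp: H_def transitive_closure_def compatible_def wf_digraph_def dest: closed)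
  moreover have "int (max_out_degree H) \<le> target I"
  proof -
    have "int (out_degree (with_proj H) u) \<le> target I" for u
    proof (cases "target I = 0")
      case True
      then have "out_arcs (with_proj H) u = {}" using g by (auto simp: out_arcs_def H_def)
      then show ?thesis using assms(2) by (simp add: out_degree_def)
    next
      case False
      have "out_arcs (with_proj H) u \<subseteq> {(u, g u)}" by (auto simp: out_arcs_def H_def)
      then have "out_degree (with_proj H) u \<le> 1"
        unfolding out_degree_def by (metis card_mono card_1_singleton_iff finite.emptyI finite.insertI One_nat_def)
      then show ?thesis using False assms(2) by linarith
    qed
    moreover have "finite (pverts H)" unfolding H_def using finite_verts by simp
    then have "max_out_degree H \<in> insert 0 (out_degree (with_proj H) ` pverts H)"
      unfolding max_out_degree_def by (intro Max_in) auto
    ultimately show ?thesis using assms(2) by auto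
  qed
  moreover have "\<exists>q. dipath (digraph_inter H (transitive_closure (path_digraph P))) s q t"
    if k: "(s, t, P) \<in> commodities I" for s t P
  proof -
    have P: "P \<noteq> []" "distinct P" "set P \<subseteq> pverts ?D" "set (vwalk_arcs P) \<subseteq> parcs ?D" "last P = t"
      using valid k unfolding md_spp_valid_def by (auto simp: dipath_iff)
    from scan[OF k] orbit_scan_iff[OF P(2,1)] obtain q where
      q: "subseq (s # q) P" "last (s # q) = last P" "successively (\<lambda>u v. v = g u) (s # q)" by metis
    have set_q: "set (s # q) \<subseteq> set P" and "distinct (s # q)"
      using q(1) P(2) distinct_subseq set_subseq by blast+
    have "u \<noteq> v" if uv: "(u, v) \<in> set (vwalk_arcs (s # q))" for u v
    proof -
      obtain A B where "s # q = A @ u # v # B" using uv unfolding vwalk_arcs_append_Cons by blast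
      then have "distinct (A @ u # v # B)" using \<open>distinct (s # q)\<close> by simp
      then show ?thesis by simp
    qed
    \<comment> \<open>A subsequence of \<open>P\<close> has its arcs in T(P), hence in T(D), so the
      intersection in \<open>H\<close> loses no arc of the route.\<close>
    moreover have "set (vwalk_arcs (s # q)) \<subseteq> (parcs ?D)\<^sup>+"
      using vwalk_arcs_subset_iff_subseq[OF P(2) set_q] q(1) trancl_mono_subset[OF P(4)] by blast
    ultimately have "set (vwalk_arcs (s # q)) \<subseteq> parcs H"
      using q(3) unfolding successively_vwalk_arcs H_def by auto
    then show ?thesis
      unfolding dipath_inter_path_iff[OF P(2)] using q(1,2) P(3,5) set_q
      by (intro exI[of _ "s # q"]) (auto simp: H_def)
  qed
  ultimately show ?thesis unfolding md_spp_solvable_def by blast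
qed

text \<open>Both ends of \<open>q\<close> lie in \<open>X\<close> and survive the filter, so the
  shortened route still joins them, and it is still a subsequence of \<open>P\<close>.\<close>

lemma orbit_scan_return_map:
  assumes P: "P \<noteq> []" "distinct P" and q: "q \<noteq> []" "subseq q P" "last q = last P"
    and X: "hd q \<in> X" "last q \<in> X" and h: "successively (\<lambda>u v. v = h u) q"
  shows "orbit_scan (return_map h X) (b, hd q) P"
proof -
  obtain a r where a: "q = a # r" using q(1) by (cases q) auto
  let ?q = "filter (\<lambda>v. v \<in> X) q"
  have "?q = hd q # filter (\<lambda>v. v \<in> X) r" using X(1) a by simp
  moreover have "last ?q = last q"
    using X(2) q(1) by (induction q rule: rev_induct) auto
  moreover have "subseq ?q P" using q(2) subseq_filter_left subseq_order.order_trans by blast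
  ultimately show ?thesis
    unfolding orbit_scan_iff[OF P(2,1)] using q(3) successively_return_map_filter[OF h, of X] by metis
qed

lemma md_spp_solvableE:
  assumes valid: "md_spp_valid I" and "target I \<le> 1" and "md_spp_solvable I"
    and X: "\<And>s t P. (s, t, P) \<in> commodities I \<Longrightarrow> s \<in> X \<and> t \<in> X"
  obtains g where "0 \<le> target I" "g ` X \<subseteq> X" "\<And>v. v \<notin> X \<Longrightarrow> g v = v" "target I = 0 \<Longrightarrow> g = id"
    "\<And>s t P. (s, t, P) \<in> commodities I \<Longrightarrow> orbit_scan g (False, s) P"
proof -
  let ?D = "base_digraph I"
  interpret pair_fin_digraph ?D using valid unfolding md_spp_valid_def by blast
  obtain H where sub: "subgraph (with_proj H) (with_proj (transitive_closure ?D))"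
    and deg: "int (max_out_degree H) \<le> target I"
    and routes: "\<And>s t P. (s, t, P) \<in> commodities I \<Longrightarrow>
      \<exists>q. dipath (digraph_inter H (transitive_closure (path_digraph P))) s q t"
    using assms(3) unfolding md_spp_solvable_def by blast
  have "pverts H \<subseteq> pverts ?D" using sub by (auto simp: subgraph_def transitive_closure_def)
  then have fin: "finite (pverts H)" using pair_finite_verts finite_subset by blast
  have arcs: "parcs H \<subseteq> pverts H \<times> pverts H" using sub by (auto simp: subgraph_def wf_digraph_def)
  have out: "int (card {a \<in> parcs H. fst a = u}) \<le> target I" if "u \<in> pverts H" for u
  proof -
    have "out_degree (with_proj H) u \<le> max_out_degree H"
      unfolding max_out_degree_def using fin that by (intro Max_ge) auto
    then show ?thesis using deg by (simp add: out_degree_def out_arcs_def)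
  qed
  \<comment> \<open>An infinite set has \<open>card\<close> 0, so the degree bound says something
    only once finiteness is known.\<close>
  have finite_arcs: "finite {a \<in> parcs H. fst a = u}" for u
    using fin arcs finite_subset[of "{a \<in> parcs H. fst a = u}" "pverts H \<times> pverts H"] by blast
  \<comment> \<open>Arbitrary at a vertex without outgoing arc; routes never continue from such a
    vertex.\<close>
  define h where "h u = (SOME v. (u, v) \<in> parcs H)" for u
  have h: "v = h u" if "(u, v) \<in> parcs H" for u v
  proof -
    have "(u, h u) \<in> parcs H" unfolding h_def using that by (rule someI)
    moreover have "card {a \<in> parcs H. fst a = u} \<le> Suc 0" using out[of u] that arcs assms(2) by fastforce
    ultimately show ?thesis
      using that finite_arcs[of u] card_le_Suc0_iff_eq[OF finite_arcs[of u]] by auto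
  qed
  define g where "g = (if target I = 0 then id else return_map h X)"
  show ?thesis
  proof
    show "0 \<le> target I" using deg by linarith
    show "g ` X \<subseteq> X" by (auto simp: g_def return_map_mem)
    show "g v = v" if "v \<notin> X" for v using that by (simp add: g_def return_map_def)
    show "g = id" if "target I = 0" using that by (simp add: g_def)
    fix s t P
    assume k: "(s, t, P) \<in> commodities I"
    then have P: "P \<noteq> []" "distinct P" "last P = t"
      using valid unfolding md_spp_valid_def by (auto simp: dipath_iff)
    from routes[OF k] obtain q where q: "q \<noteq> []" "subseq q P" "set (vwalk_arcs q) \<subseteq> parcs H"
        "hd q = s" "last q = t"
      unfolding dipath_inter_path_iff[OF P(2)] by blast
    show "orbit_scan g (False, s) P"
    proof (cases "target I = 0")
      case True
      have "parcs H = {}"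
      proof (rule ccontr)
        assume "parcs H \<noteq> {}"
        then obtain u v where uv: "(u, v) \<in> parcs H" by auto
        then have "card {a \<in> parcs H. fst a = u} = 0" using out[of u] arcs True by auto
        then show False using uv finite_arcs[of u] by auto
      qed
      then have "q = [s]" using q by (cases q rule: vwalk_arcs.cases) auto
      then show ?thesis
        unfolding orbit_scan_iff[OF P(2,1)] using q P by (intro exI[of _ "[]"]) auto
    next
      case False
      have "successively (\<lambda>u v. v = h u) q" using q(3) h unfolding successively_vwalk_arcs by blast
      from orbit_scan_return_map[OF P(1,2) q(1,2) _ _ _ this] show ?thesis
        using q P X[OF k] False by (simp add: g_def)
    qed
  qed
qed

section \<open>Correctness of the algorithm\<close>

lemma bits_inj: "bits m = bits n \<Longrightarrow> m = n"
proof (induction m arbitrary: n rule: less_induct)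
  case (less m)
  show ?case
  proof (cases "m = 0 \<or> n = 0")
    case True
    then show ?thesis using less.prems by (auto simp: bits.simps[of m] bits.simps[of n] bits.simps[of 0] split: if_splits)
  next
    case False
    then have parity: "odd m = odd n" and half: "bits (m div 2) = bits (n div 2)"
      using less.prems by (simp_all add: bits.simps[of m] bits.simps[of n])
    have "m div 2 = n div 2" using less.IH[OF _ half] False by simp
    with parity show ?thesis by (metis div_mult_mod_eq odd_iff_mod_2_eq_one even_iff_mod_2_eq_zero)
  qed
qed

lemma enc_nat_eq_Leaf_iff: "enc_nat n = Leaf \<longleftrightarrow> n = 0"
  by (simp add: enc_nat_def bits.simps[of n])

lemma eq_nat_enc_list: "eq_nat (enc_list enc_bool as) (enc_list enc_bool bs) \<longleftrightarrow> as = bs"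
proof -
  have Leaf: "foldl eq_step Leaf xs = Leaf" for xs by (induction xs) (auto simp: eq_step_def)
  show ?thesis
  proof (induction as arbitrary: bs)
    case Nil
    then show ?case by (cases bs) (auto simp: eq_nat_def enc_bool_def)
  next
    case (Cons a as)
    show ?case
    proof (cases bs)
      case Nil
      then show ?thesis by (simp add: eq_nat_def eq_step_def Leaf)
    next
      case (Cons b bs')
      then have "eq_nat (enc_list enc_bool (a # as)) (enc_list enc_bool bs) \<longleftrightarrow>
          a = b \<and> eq_nat (enc_list enc_bool as) (enc_list enc_bool bs')"
        by (cases a; cases b) (simp_all add: eq_nat_def eq_step_def Leaf enc_bool_def)
      then show ?thesis using Cons Cons.IH by simp
    qed
  qed
qed

lemma eq_nat_enc_nat: "eq_nat (enc_nat m) (enc_nat n) \<longleftrightarrow> m = n"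
  using bits_inj by (auto simp: enc_nat_def eq_nat_enc_list)

section \<open>Encoded assignments and commodities\<close>

abbreviation enc_assignment :: "(nat \<times> nat) list \<Rightarrow> data" where
  "enc_assignment \<equiv> enc_list (enc_pair enc_nat enc_nat)"

abbreviation enc_commodity :: "nat \<times> nat \<times> nat list \<Rightarrow> data" where
  "enc_commodity \<equiv> enc_pair enc_nat (enc_pair enc_nat (enc_list enc_nat))"

definition lookup :: "(nat \<times> nat) list \<Rightarrow> nat \<Rightarrow> nat" where
  "lookup c v = foldl (\<lambda>r (u, w). if v = u then w else r) v c"

lemma successor_enc: "successor (enc_assignment c) (enc_nat v) = enc_nat (lookup c v)"
proof -
  have "foldl (\<lambda>r p. if eq_nat (enc_nat v) (left p) then right p else r) (enc_nat r) (map (enc_pair enc_nat enc_nat) c)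
      = enc_nat (foldl (\<lambda>r (u, w). if v = u then w else r) r c)" for r
    by (induction c arbitrary: r) (auto simp: enc_pair_def eq_nat_enc_nat)
  then show ?thesis by (simp add: successor_def lookup_def elems_enc_list)
qed

text \<open>All entries for a vertex agree with \<open>f\<close>, so it does not matter which of
  several wins. This is why repeated terminals do no harm.\<close>

lemma lookup_graph:
  assumes "\<And>u w. (u, w) \<in> set c \<Longrightarrow> w = f u"
  shows "lookup c v = (if v \<in> fst ` set c then f v else v)"
proof -
  have "foldl (\<lambda>r (u, w). if v = u then w else r) r c = (if v \<in> fst ` set c then f v else r)" for r
    using assms by (induction c arbitrary: r) auto
  then show ?thesis by (simp add: lookup_def)
qed

lemma routed_enc:
  "routed (enc_assignment c) (enc_commodity (s, t, P)) \<longleftrightarrow> orbit_scan (lookup c) (False, s) P"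
proof -
  have "left (foldl (scan_step (enc_assignment c)) (Node (enc_bool b) (enc_nat e)) (map enc_nat P)) \<noteq> Leaf
      \<longleftrightarrow> orbit_scan (lookup c) (b, e) P" for b e
  proof (induction P arbitrary: b e)
    case Nil
    then show ?case by (simp add: enc_bool_def)
  next
    case (Cons v P)
    have "scan_step (enc_assignment c) (Node (enc_bool b) (enc_nat e)) (enc_nat v) =
        (if v = e then Node (enc_bool True) (enc_nat (lookup c v)) else Node (enc_bool False) (enc_nat e))"
      by (simp add: scan_step_def eq_nat_enc_nat successor_enc) (simp add: enc_bool_def)
    then show ?case using Cons.IH by simp
  qed
  from this[of False s] show ?thesis by (simp add: routed_def enc_pair_def elems_enc_list enc_bool_def)
qed

lemma terminals_enc:
  obtains ts where "terminals (enc_list enc_commodity K) = enc_list enc_nat ts"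
    "set ts = (\<Union>(s, t, P) \<in> set K. {s, t})"
proof -
  have "\<exists>ts'. foldl (\<lambda>r k. Node (left k) (Node (left (right k)) r)) (enc_list enc_nat ts) (map enc_commodity K)
      = enc_list enc_nat ts' \<and> set ts' = set ts \<union> (\<Union>(s, t, P) \<in> set K. {s, t})" for ts
  proof (induction K arbitrary: ts)
    case (Cons k K)
    obtain s t P where k: "k = (s, t, P)" by (cases k)
    show ?case using Cons.IH[of "s # t # ts"] by (auto simp: k enc_pair_def)
  qed auto
  from this[of "[]"] that show thesis by (auto simp: terminals_def elems_enc_list)
qed

text \<open>Nothing is claimed about the values in the table: for a positive target,
  \<open>md_spp_solvableI\<close> accepts any map that routes all commodities.\<close>

lemma assignments_sound:
  assumes "c \<in> set (elems (assignments (enc_list enc_nat ts)))"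
  obtains c' where "c = enc_assignment c'"
proof -
  have step: "set (elems (foldl (extend_all (enc_list enc_nat ts)) cs (map enc_nat us))) \<subseteq> range enc_assignment"
    if "set (elems cs) \<subseteq> range enc_assignment" for cs us
    using that
  proof (induction us arbitrary: cs)
    case (Cons u us)
    have "set (elems (extend_all (enc_list enc_nat ts) cs (enc_nat u))) \<subseteq> range enc_assignment"
    proof
      fix d
      assume "d \<in> set (elems (extend_all (enc_list enc_nat ts) cs (enc_nat u)))"
      then obtain c w where d: "d = Node (Node (enc_nat u) (enc_nat w)) c" and "c \<in> set (elems cs)"
        by (auto simp: set_elems_extend_all elems_enc_list)
      then obtain c' where "c = enc_assignment c'" using Cons.prems by auto
      then have "d = enc_assignment ((u, w) # c')" by (simp add: d enc_pair_def)
      then show "d \<in> range enc_assignment" by blast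
    qed
    then show ?case using Cons.IH by simp
  qed simp
  have "set (elems (Node Leaf Leaf)) \<subseteq> range enc_assignment"
    by (auto intro: image_eqI[of _ _ "[]"])
  from step[OF this, of ts] assms that show thesis by (auto simp: assignments_def elems_enc_list)
qed

text \<open>In the round of \<open>u\<close> the extension by \<open>f u\<close> is among those
  listed. New entries are put in front, hence the \<open>rev\<close>.\<close>

lemma assignments_complete:
  assumes "f ` set ts \<subseteq> set ts"
  shows "enc_assignment (rev (map (\<lambda>u. (u, f u)) ts)) \<in> set (elems (assignments (enc_list enc_nat ts)))"
proof -
  have "enc_assignment (rev (map (\<lambda>u. (u, f u)) us) @ c) \<in>
      set (elems (foldl (extend_all (enc_list enc_nat ts)) cs (map enc_nat us)))"
    if "enc_assignment c \<in> set (elems cs)" "set us \<subseteq> set ts" for c cs us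
    using that
  proof (induction us arbitrary: c cs)
    case (Cons u us)
    have "enc_assignment ((u, f u) # c) = (\<lambda>(c, w). Node (Node (enc_nat u) w) c) (enc_assignment c, enc_nat (f u))"
      by (simp add: enc_pair_def)
    moreover have "f u \<in> set ts" using Cons.prems(2) assms by auto
    ultimately have "enc_assignment ((u, f u) # c) \<in> set (elems (extend_all (enc_list enc_nat ts) cs (enc_nat u)))"
      unfolding set_elems_extend_all elems_enc_list using Cons.prems(1) by (intro image_eqI) auto
    from Cons.IH[OF this] Cons.prems(2) show ?case by simp
  qed simp
  from this[of "[]" "Node Leaf Leaf" ts] show ?thesis by (simp add: assignments_def elems_enc_list)
qed

lemma decide_correct:
  assumes valid: "md_spp_valid I" and le: "target I \<le> 1" and x: "x \<in> md_spp_encodings I"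
  shows "decide x \<longleftrightarrow> md_spp_solvable I"
proof -
  from x obtain d K where x_eq: "x = Node d (Node (enc_int (target I)) (enc_list enc_commodity K))"
    and K: "set K = commodities I"
    unfolding md_spp_encodings_def enc_set_def by auto
  obtain ts where ts: "terminals (enc_list enc_commodity K) = enc_list enc_nat ts"
    and set_ts: "set ts = (\<Union>(s, t, P) \<in> set K. {s, t})" by (rule terminals_enc)
  define us where "us = (if target I = 0 then [] else ts)"
  have "(if right (left (right x)) \<noteq> Leaf then terminals (right (right x)) else Leaf) = enc_list enc_nat us"
    by (simp add: x_eq us_def enc_int_def enc_nat_eq_Leaf_iff ts)
  then have decide_iff: "decide x \<longleftrightarrow> 0 \<le> target I \<and>
      (\<exists>c \<in> set (elems (assignments (enc_list enc_nat us))).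
        \<forall>k \<in> commodities I. routed c (enc_commodity k))"
    unfolding decide_def using K by (auto simp: x_eq enc_int_def enc_bool_def elems_enc_list)
  show ?thesis
  proof
    assume "decide x"
    then obtain c where c: "c \<in> set (elems (assignments (enc_list enc_nat us)))" "0 \<le> target I"
      "\<And>k. k \<in> commodities I \<Longrightarrow> routed c (enc_commodity k)" unfolding decide_iff by blast
    obtain c' where c': "c = enc_assignment c'" using assignments_sound[OF c(1)] .
    have "lookup c' = id" if "target I = 0"
    proof -
      have "length (elems c) = 0" using length_elems_assignment[OF c(1)] that by (simp add: us_def)
      then show ?thesis by (auto simp: c' elems_enc_list lookup_def)
    qed
    moreover have "orbit_scan (lookup c') (False, s) P" if "(s, t, P) \<in> commodities I" for s t P
      using c(3)[OF that] unfolding c' routed_enc .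
    ultimately show "md_spp_solvable I" by (intro md_spp_solvableI[OF valid c(2)])
  next
    assume "md_spp_solvable I"
    moreover have "s \<in> set ts \<and> t \<in> set ts" if "(s, t, P) \<in> commodities I" for s t P
      using that by (force simp: set_ts K)
    ultimately obtain g where g: "0 \<le> target I" "g ` set ts \<subseteq> set ts" "\<And>v. v \<notin> set ts \<Longrightarrow> g v = v"
      "target I = 0 \<Longrightarrow> g = id" "\<And>s t P. (s, t, P) \<in> commodities I \<Longrightarrow> orbit_scan g (False, s) P"
      using md_spp_solvableE[OF valid le, of "set ts"] by metis
    let ?c = "rev (map (\<lambda>u. (u, g u)) us)"
    have "enc_assignment ?c \<in> set (elems (assignments (enc_list enc_nat us)))"
      by (rule assignments_complete) (use g(2) in \<open>auto simp: us_def\<close>)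
    \<comment> \<open>Vertices without entry are fixed by \<open>g\<close>: they are not terminals,
      or the target is 0 and \<open>g = id\<close>.\<close>
    moreover have "lookup ?c v = g v" for v
    proof -
      have "lookup ?c v = (if v \<in> fst ` set ?c then g v else v)" by (rule lookup_graph) auto
      then show ?thesis using g(3,4) by (auto simp: us_def image_iff)
    qed
    then have lookup: "lookup ?c = g" by blast
    have "routed (enc_assignment ?c) (enc_commodity (s, t, P))" if "(s, t, P) \<in> commodities I" for s t P
      unfolding routed_enc lookup using that by (rule g(5))
    ultimately show "decide x"
      unfolding decide_iff using g(1) by fast
  qed
qed

theorem theorem5:
  shows "fixed_parameter_tractable (restrict_problem md_spp (\<lambda>I. target I \<le> 1))"
proof -
  obtain p C where p: "realizes p (\<lambda>x. enc_bool (decide x)) (\<lambda>x. C * Suc (search_bound x * data_size x ^ 2))"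
    using computes_in_decide unfolding computes_in_def by blast
  define f :: "nat \<Rightarrow> nat" where "f n = (2 * n) ^ (2 * n)" for n
  have "\<exists>t y. runs p x t y \<and> t \<le> f (card (commodities I)) * data_size x ^ (2 * C + 2) \<and>
      (y \<noteq> Leaf \<longleftrightarrow> md_spp_solvable I)"
    if valid: "md_spp_valid I" and le: "target I \<le> 1" and x: "x \<in> md_spp_encodings I" for I x
  proof -
    obtain t \<sigma> where t: "exec p ((\<lambda>_. Leaf)(0 := x)) t \<sigma>" "\<sigma> 0 = enc_bool (decide x)"
        "t \<le> C * Suc (search_bound x * data_size x ^ 2)"
      by (rule realizesE[OF p, of "(\<lambda>_. Leaf)(0 := x)"]) simp
    obtain d e K where x_eq: "x = Node d (Node e (enc_list enc_commodity K))"
      and K: "distinct K" "set K = commodities I"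
      using x unfolding md_spp_encodings_def enc_set_def by auto
    \<comment> \<open>The encoding lists every commodity exactly once, so the length seen by the
      program is the parameter.\<close>
    have bound: "search_bound x = f (card (commodities I))"
      using distinct_card[OF K(1)] K(2) by (simp add: x_eq search_bound_def f_def elems_enc_list)
    \<comment> \<open>Again \<open>0 ^ 0 = 1\<close>. Positivity lets a factor 2 replace the
      \<open>Suc\<close> in the time bound.\<close>
    have pos: "0 < f (card (commodities I))" by (cases "card (commodities I)") (auto simp: f_def)
    have "2 \<le> data_size x" using data_size_pos[of d] by (simp add: x_eq)
    have "t \<le> C * (2 * (search_bound x * data_size x ^ 2))"
      using t(3) pos \<open>2 \<le> data_size x\<close> by (elim order_trans, intro mult_le_mono2) (simp add: bound Suc_le_eq)
    also have "\<dots> = f (card (commodities I)) * ((C * 2) * data_size x ^ 2)" by (simp add: bound)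
    also have "\<dots> \<le> f (card (commodities I)) * (data_size x ^ (2 * C) * data_size x ^ 2)"
    proof (intro mult_le_mono2 mult_le_mono1)
      \<comment> \<open>The constant factor is moved into the exponent, which works because every
        input has size at least 2.\<close>
      have "C * 2 \<le> 2 ^ (2 * C)" using less_exp[of "2 * C"] by linarith
      also have "\<dots> \<le> data_size x ^ (2 * C)" using \<open>2 \<le> data_size x\<close> by (rule power_mono) simp
      finally show "C * 2 \<le> data_size x ^ (2 * C)" .
    qed
    finally have "t \<le> f (card (commodities I)) * data_size x ^ (2 * C + 2)" by (simp only: power_add)
    moreover have "enc_bool (decide x) \<noteq> Leaf \<longleftrightarrow> md_spp_solvable I"
      using decide_correct[OF that] by (simp add: enc_bool_def)
    ultimately show ?thesis using t(1,2) unfolding runs_def by metis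
  qed
  moreover have "computable f" unfolding f_def[abs_def] by (rule computable_search_bound)
  ultimately show ?thesis
    unfolding fixed_parameter_tractable_def restrict_problem_def md_spp_def
    by (intro exI[of _ p] exI[of _ f] exI[of _ "2 * C + 2"]) auto
qed

end
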